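(* Fix real numbers $u'<u<0<s<s'$ and $\lambda'>1$. Then there exist uncountably many $\lambda\in[\lambda',+\infty)$ such that the pair $\mathbb{A}_\lambda=(H_{s,u}^{\lambda},H_{s',u'}^{\lambda'})$ is a finiteness counter-example.
   Context: For $\lambda>1$ and $u<0<s$ let $$H_{s,u}^\lambda=\begin{pmatrix} s&u\\1&1\end{pmatrix}\begin{pmatrix}\lambda&0\\0&\lambda^{-1}\end{pmatrix}\begin{pmatrix} s&u\\1&1\end{pmatrix}^{-1}\in\mathrm{SL}(2,\mathbb{R}).$$ (The pair $\mathbb{A}_\lambda$ is what is called a co-parallel pair.) Let $\mathbf{G}=\{X\in \mathrm{GL}(2,\mathbb{R}):\det X>0\}$ and let $\rho(X)$ denote the spectral radius of $X$. For $\mathbb{A}=(A,B)\in\mathbf{G}^2$ the joint spectral radius is $$\hat\rho(\mathbb{A})=\limsup_{n\to\infty}\left(\max\{\rho(X_1\cdots X_n):X_1,\dots,X_n\in\{A,B\}\}\right)^{1/n}.$$ A finite product $X_1\cdots X_n$ ($n\ge1$, $X_i\in\{A,B\}$) is a spectrum maximizing product of $\mathbb{A}$ if $\rho(X_1\cdots X_n)^{1/n}=\hat\rho(\mathbb{A})$. The pair $\mathbb{A}$ is called a finiteness counter-example if it admits no spectrum maximizing product. *)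

theory Defs
  imports
    "HOL-Library.Countable_Set"
    "HOL-Library.Extended_Real"
    "HOL-Library.Liminf_Limsup"
    "Jordan_Normal_Form.Gauss_Jordan_Elimination"
    "Jordan_Normal_Form.Determinant"
    "Jordan_Normal_Form.Spectral_Radius"
begin

definition GL2_pos :: "real mat set" where
  "GL2_pos = {X \<in> carrier_mat 2 2. det X > 0}"

definition real_spectral_radius :: "real mat \<Rightarrow> real" where
  "real_spectral_radius X = spectral_radius (map_mat complex_of_real X)"

definition mat2_prod :: "real mat list \<Rightarrow> real mat" where
  "mat2_prod Xs = foldr (*) Xs (1\<^sub>m 2)"

definition words :: "real mat \<Rightarrow> real mat \<Rightarrow> nat \<Rightarrow> real mat list set" where
  "words A B n = {Xs. length Xs = n \<and> set Xs \<subseteq> {A, B}}"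

text \<open>The limsup is taken in the complete lattice of extended reals, so that it needs
  no boundedness side condition. The term at \<open>n = 0\<close> is \<open>root 0 _ = 0\<close> and does not
  affect it.\<close>

definition joint_spectral_radius :: "real mat \<Rightarrow> real mat \<Rightarrow> ereal" where
  "joint_spectral_radius A B =
     limsup (\<lambda>n. ereal (root n (Max ((\<lambda>Xs. real_spectral_radius (mat2_prod Xs)) ` words A B n))))"

definition spectrum_maximizing_product :: "real mat \<Rightarrow> real mat \<Rightarrow> real mat list \<Rightarrow> bool" where
  "spectrum_maximizing_product A B Xs \<longleftrightarrow>
     length Xs \<ge> 1 \<and> Xs \<in> words A B (length Xs) \<and>
     ereal (root (length Xs) (real_spectral_radius (mat2_prod Xs))) = joint_spectral_radius A B"

definition finiteness_counterexample :: "real mat \<Rightarrow> real mat \<Rightarrow> bool" where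
  "finiteness_counterexample A B \<longleftrightarrow>
     A \<in> GL2_pos \<and> B \<in> GL2_pos \<and> \<not> (\<exists>Xs. spectrum_maximizing_product A B Xs)"

definition H_base :: "real \<Rightarrow> real \<Rightarrow> real mat" where
  "H_base s u = mat_of_rows_list 2 [[s, u], [1, 1]]"

definition H :: "real \<Rightarrow> real \<Rightarrow> real \<Rightarrow> real mat" where
  "H s u l = H_base s u * mat_of_rows_list 2 [[l, 0], [0, inverse l]] * the (mat_inverse (H_base s u))"

lemma finite_words [simp]: "finite (words A B n)"
  using finite_lists_length_eq[of "{A, B}" n] by (simp add: words_def conj_commute)

lemma words_nonempty: "words A B n \<noteq> {}"
proof -
  have "replicate n A \<in> words A B n" by (auto simp: words_def)
  then show ?thesis by blast
qed

lemma mat_of_rows_list_2_carrier: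
  "length rs = 2 \<Longrightarrow> mat_of_rows_list 2 rs \<in> carrier_mat 2 2"
  by (auto simp: mat_of_rows_list_def)

lemma H_base_carrier [simp]: "H_base s u \<in> carrier_mat 2 2"
  by (simp add: H_base_def mat_of_rows_list_2_carrier)

lemma mat_inverse_H_base:
  assumes "u < s"
  shows "mat_inverse (H_base s u) =
    Some (mat_of_rows_list 2 [[1 / (s - u), - u / (s - u)], [- 1 / (s - u), s / (s - u)]])"
    (is "_ = Some ?Q")
proof -
  have P: "H_base s u \<in> carrier_mat 2 2" by simp
  have Q: "?Q \<in> carrier_mat 2 2" by (rule mat_of_rows_list_2_carrier) simp
  have d: "s - u \<noteq> 0" using assms by simp
  have PQ: "H_base s u * ?Q = 1\<^sub>m 2"
  proof (rule eq_matI)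
    fix i j :: nat
    assume "i < dim_row (1\<^sub>m 2 :: real mat)" "j < dim_col (1\<^sub>m 2 :: real mat)"
    then consider "i = 0" "j = 0" | "i = 0" "j = 1" | "i = 1" "j = 0" | "i = 1" "j = 1"
      by fastforce
    then show "(H_base s u * ?Q) $$ (i, j) = 1\<^sub>m 2 $$ (i, j)"
      using d by cases
        (simp_all add: H_base_def mat_of_rows_list_def scalar_prod_def numeral_2_eq_2
          flip: diff_divide_distrib add_divide_distrib)
  qed (simp_all add: H_base_def mat_of_rows_list_def)
  have QP: "?Q * H_base s u = 1\<^sub>m 2"
    using mat_mult_left_right_inverse[OF P Q PQ] .
  have "H_base s u \<in> Units (ring_mat TYPE(real) 2 ())"
    using P Q PQ QP by (auto simp: Units_def ring_mat_def)
  then obtain R where R: "mat_inverse (H_base s u) = Some R"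
    using mat_inverse(1)[OF P, where b = "()"] by (cases "mat_inverse (H_base s u)") auto
  have "R = (?Q * H_base s u) * R"
    using mat_inverse(2)[OF P R] QP left_mult_one_mat[of R 2 2] by metis
  also have "\<dots> = ?Q"
    using mat_inverse(2)[OF P R] P Q by (simp add: assoc_mult_mat[of _ 2 2 _ 2 _ 2])
  finally show ?thesis using R by simp
qed

lemma H_in_GL2_pos:
  assumes "u < s" "l \<noteq> 0"
  shows "det (H s u l) = 1" "H s u l \<in> GL2_pos"
proof -
  let ?P = "H_base s u" and ?D = "mat_of_rows_list 2 [[l, 0], [0, inverse l]]"
  obtain Q where Q: "mat_inverse ?P = Some Q" using mat_inverse_H_base[OF assms(1)] by blast
  have P: "?P \<in> carrier_mat 2 2" by simp
  note PQ = mat_inverse(2)[OF P Q]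
  have D: "?D \<in> carrier_mat 2 2" by (rule mat_of_rows_list_2_carrier) simp
  have "upper_triangular ?D"
    by (auto simp: upper_triangular_def mat_of_rows_list_def less_Suc_eq)
  then have "det ?D = prod_list (diag_mat ?D)"
    by (rule det_upper_triangular[OF _ D])
  then have detD: "det ?D = 1"
    using assms(2) by (simp add: diag_mat_def mat_of_rows_list_def)
  have "det ?P * det Q = det (1\<^sub>m 2)"
    using det_mult[OF P, of Q] PQ by simp
  then have detPQ: "det ?P * det Q = 1" by simp
  have "det (H s u l) = det ?P * det ?D * det Q"
    using PQ by (simp add: H_def Q det_mult[OF mult_carrier_mat[OF P D], of Q] det_mult[OF P D])
  then show det: "det (H s u l) = 1"
    using detD detPQ by simp
  have "H s u l \<in> carrier_mat 2 2"
    using PQ mult_carrier_mat[OF mult_carrier_mat[OF P D], of Q] by (simp add: H_def Q)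
  then show "H s u l \<in> GL2_pos" using det by (simp add: GL2_pos_def)
qed

end

theory Submission
  imports Defs
begin

text \<open>For a fixed \<open>\<lambda>\<close> all spectrum maximizing products have the same proportion of letters \<open>A\<close>, and
  up to rotation and powers the only candidate of a given proportion is the balanced (Christoffel)
  word. Indeed, attach to every rotation of a maximizing word the positions of its dominant column
  and row eigenvectors. Two maximizing words cannot have nested axes, since products of their powers
  would grow faster, so columns and rows are oppositely ordered. Combined with the sign of \<open>AB - BA\<close>
  this makes rotation by one letter act on the ordered row positions like a circle rotation, with the
  letter being read off from a threshold; so the word codes that rotation.

  Hence the sets of parameters in \<open>[\<lambda>', L]\<close> at which a given Christoffel word is maximizing are closed
  and pairwise equal or disjoint. If there were only countably many counter-examples, these sets and
  the single counter-examples would be a countable partition of an interval into closed sets, so by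
  Sierpinski's theorem a single set would be everything. But \<open>A\<close> is maximizing for large \<open>\<lambda>\<close> and,
  since \<open>tr AB > tr A\<^sup>2\<close>, not for \<open>\<lambda> = \<lambda>'\<close>.\<close>

section \<open>Positive unimodular two-by-two matrices\<close>

text \<open>All comparisons of growth come from one asymptotic: \<open>tr2 (Q * X ^ N)\<close> is
  \<open>rho X ^ N\<close> times the value of \<open>Q\<close> between the dominant row and column
  of \<open>X\<close>, up to normalisation. Inserting a word into high powers of a maximizing word
  therefore bounds a bilinear form at the eigenvectors of that word. The antichain property and the
  exchange of two letters are both instances of this bound.

  The shape of the words matters for the topological step. Two Christoffel words of equal proportion
  have a common power, and a word and its powers are maximizing at the same parameters. So two words
  that are maximizing at one common parameter are maximizing together at every parameter, which is
  why parameter sets that meet coincide. They are closed because each is cut out by inequalities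
  between spectral radii of fixed words, continuous in the parameter.\<close>

datatype m2 = M2 (e11: real) (e12: real) (e21: real) (e22: real)

instantiation m2 :: monoid_mult
begin

definition one_m2 :: m2 where "1 = M2 1 0 0 1"

definition times_m2 :: "m2 \<Rightarrow> m2 \<Rightarrow> m2" where
  "X * Y = M2 (e11 X * e11 Y + e12 X * e21 Y) (e11 X * e12 Y + e12 X * e22 Y)
     (e21 X * e11 Y + e22 X * e21 Y) (e21 X * e12 Y + e22 X * e22 Y)"

instance
  by standard (simp_all add: one_m2_def times_m2_def algebra_simps)

end

lemma entries_mult [simp]:
  "e11 (X * Y) = e11 X * e11 Y + e12 X * e21 Y"
  "e12 (X * Y) = e11 X * e12 Y + e12 X * e22 Y"
  "e21 (X * Y) = e21 X * e11 Y + e22 X * e21 Y"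
  "e22 (X * Y) = e21 X * e12 Y + e22 X * e22 Y"
  by (simp_all add: times_m2_def)

lemma entries_one [simp]: "e11 1 = 1" "e12 1 = 0" "e21 1 = 0" "e22 1 = 1"
  by (simp_all add: one_m2_def)

definition tr2 :: "m2 \<Rightarrow> real" where
  "tr2 X = e11 X + e22 X"

definition det2 :: "m2 \<Rightarrow> real" where
  "det2 X = e11 X * e22 X - e12 X * e21 X"

definition pos1 :: "m2 \<Rightarrow> bool" where
  "pos1 X \<longleftrightarrow> e11 X > 0 \<and> e12 X > 0 \<and> e21 X > 0 \<and> e22 X > 0 \<and> det2 X = 1"

text \<open>The larger root of \<open>t * t - tr2 X * t + 1\<close>, the characteristic polynomial
  for determinant 1.\<close>

definition rho :: "m2 \<Rightarrow> real" where
  "rho X = (tr2 X + sqrt ((tr2 X)\<^sup>2 - 4)) / 2"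

definition mob :: "m2 \<Rightarrow> real \<Rightarrow> real" where
  "mob X x = (e11 X * x + e12 X) / (e21 X * x + e22 X)"

text \<open>Solves \<open>e21 X * x + e22 X = rho X\<close>, the second row of the eigenvalue
  equation for the column \<open>(x, 1)\<close>. Thus \<open>(fixpt X, 1)\<close> is the dominant
  column eigenvector.\<close>

definition fixpt :: "m2 \<Rightarrow> real" where
  "fixpt X = (rho X - e22 X) / e21 X"

text \<open>Conjugating the transpose by the coordinate swap turns the action of \<open>X\<close> on rows
  \<open>(1, \<eta>)\<close> into the column action \<^term>\<open>mob (flip X)\<close>; in particular
  \<^term>\<open>fixpt (flip X)\<close> represents the dominant row eigenvector of \<open>X\<close>.\<close>

definition flip :: "m2 \<Rightarrow> m2" where
  "flip X = M2 (e22 X) (e12 X) (e21 X) (e11 X)"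

text \<open>The row \<open>(1, \<eta>)\<close> times \<open>X\<close> times the column
  \<open>(x, 1)\<close>.\<close>

definition form :: "m2 \<Rightarrow> real \<Rightarrow> real \<Rightarrow> real" where
  "form X \<eta> x = e11 X * x + e12 X + \<eta> * (e21 X * x + e22 X)"

lemma entries_flip [simp]:
  "e11 (flip X) = e22 X" "e12 (flip X) = e12 X" "e21 (flip X) = e21 X" "e22 (flip X) = e11 X"
  by (simp_all add: flip_def)

lemma flip_flip [simp]: "flip (flip X) = X"
  by (simp add: flip_def)

lemma flip_one [simp]: "flip 1 = 1"
  by (simp add: flip_def one_m2_def)

lemma flip_mult: "flip (X * Y) = flip Y * flip X"
  by (simp add: flip_def times_m2_def algebra_simps)

lemma tr2_flip [simp]: "tr2 (flip X) = tr2 X"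
  by (simp add: tr2_def)

lemma rho_flip [simp]: "rho (flip X) = rho X"
  by (simp add: rho_def)

lemma pos1_flip [simp]: "pos1 (flip X) = pos1 X"
  by (auto simp: pos1_def det2_def algebra_simps)

lemma tr2_commute: "tr2 (X * Y) = tr2 (Y * X)"
  by (simp add: tr2_def algebra_simps)

lemma rho_commute: "rho (X * Y) = rho (Y * X)"
  by (simp add: rho_def tr2_commute)

lemma det2_mult: "det2 (X * Y) = det2 X * det2 Y"
  by (simp add: det2_def algebra_simps)

lemma pos1_mult: "pos1 X \<Longrightarrow> pos1 Y \<Longrightarrow> pos1 (X * Y)"
  by (simp add: pos1_def det2_mult add_pos_pos)

lemma form_flip: "form X \<eta> x = form (flip X) x \<eta>"
  by (simp add: form_def algebra_simps)

section \<open>Dominant eigenvalue and attracting fixed point of a single matrix\<close>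

context
  fixes X assumes X: "pos1 X"
begin

lemma pos1_entries: "e11 X > 0" "e12 X > 0" "e21 X > 0" "e22 X > 0"
  "e11 X * e22 X = 1 + e12 X * e21 X"
  using X by (auto simp: pos1_def det2_def)

lemma tr2_gt_2: "tr2 X > 2"
proof -
  have "(tr2 X)\<^sup>2 = (e11 X - e22 X)\<^sup>2 + 4 * (e11 X * e22 X)"
    by (simp add: tr2_def power2_eq_square algebra_simps)
  also have "\<dots> = (e11 X - e22 X)\<^sup>2 + 4 * (e12 X * e21 X) + 2\<^sup>2"
    by (simp add: pos1_entries(5))
  also have "\<dots> > 2\<^sup>2"
    using pos1_entries(2,3) by (simp add: add_nonneg_pos)
  finally have "2\<^sup>2 < (tr2 X)\<^sup>2" .
  then show ?thesis
    using pos1_entries(1,4) by (intro power2_less_imp_less[of 2]) (auto simp: tr2_def)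
qed

lemma rho_root: "rho X * rho X = tr2 X * rho X - 1"
proof -
  have "2\<^sup>2 < (tr2 X)\<^sup>2" using tr2_gt_2 by (intro power_strict_mono) auto
  then have "(sqrt ((tr2 X)\<^sup>2 - 4))\<^sup>2 = (tr2 X)\<^sup>2 - 4"
    by (intro real_sqrt_pow2) simp
  moreover have "rho X * 2 = tr2 X + sqrt ((tr2 X)\<^sup>2 - 4)"
    by (simp add: rho_def)
  ultimately have "(rho X * 2 - tr2 X)\<^sup>2 = (tr2 X)\<^sup>2 - 4" by simp
  then show ?thesis by (simp add: power2_eq_square algebra_simps)
qed

lemma rho_gt_1: "rho X > 1"
proof -
  have "2\<^sup>2 < (tr2 X)\<^sup>2" using tr2_gt_2 by (intro power_strict_mono) auto
  then have "0 \<le> sqrt ((tr2 X)\<^sup>2 - 4)" by simp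
  moreover have "rho X * 2 = tr2 X + sqrt ((tr2 X)\<^sup>2 - 4)" by (simp add: rho_def)
  ultimately show ?thesis using tr2_gt_2 by linarith
qed

lemma tr2_eq_rho: "tr2 X = rho X + 1 / rho X"
  using rho_root rho_gt_1 by (simp add: field_simps)

lemma rho_root': "(rho X - e11 X) * (rho X - e22 X) = e12 X * e21 X"
  using rho_root pos1_entries(5) by (simp add: tr2_def algebra_simps)

lemma rho_gt_entries: "rho X > e11 X" "rho X > e22 X"
proof -
  have p: "(rho X - e11 X) * (rho X - e22 X) > 0"
    using pos1_entries by (simp add: rho_root')
  moreover have "\<not> (rho X < e11 X \<and> rho X < e22 X)"
  proof
    assume "rho X < e11 X \<and> rho X < e22 X"
    moreover have "rho X \<ge> tr2 X / 2"
    proof -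
      have "2\<^sup>2 < (tr2 X)\<^sup>2" using tr2_gt_2 by (intro power_strict_mono) auto
      then show ?thesis by (simp add: rho_def)
    qed
    ultimately show False by (simp add: tr2_def)
  qed
  ultimately show "rho X > e11 X" "rho X > e22 X"
    by (auto simp: zero_less_mult_iff)
qed

lemma fixpt_pos: "fixpt X > 0" "fixpt (flip X) > 0"
  using rho_gt_entries pos1_entries by (simp_all add: fixpt_def)

lemma denom_pos: "z > 0 \<Longrightarrow> e21 X * z + e22 X > 0"
  using pos1_entries by (simp add: add_pos_pos)

lemma mob_pos: "z > 0 \<Longrightarrow> mob X z > 0"
  using pos1_entries by (simp add: mob_def add_pos_pos)

text \<open>The numerator is a quadratic in \<open>z\<close> whose roots are the two fixed points;
  the repelling one is \<open>- fixpt (flip X)\<close>, hence negative. On positive \<open>z\<close>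
  only the factor \<open>fixpt X - z\<close> can change sign.\<close>

lemma mob_diff_self:
  assumes "z > 0"
  shows "mob X z - z = e21 X * (fixpt X - z) * (z + fixpt (flip X)) / (e21 X * z + e22 X)"
proof -
  have "fixpt X * e21 X = rho X - e22 X" "fixpt (flip X) * e21 X = rho X - e11 X"
    using pos1_entries by (simp_all add: fixpt_def)
  then have "e21 X * (e21 X * (fixpt X - z) * (z + fixpt (flip X)))
      = e21 X * (e11 X * z + e12 X - z * (e21 X * z + e22 X))"
    using rho_root' by Groebner_Basis.algebra
  then have "e21 X * (fixpt X - z) * (z + fixpt (flip X)) = e11 X * z + e12 X - z * (e21 X * z + e22 X)"
    using pos1_entries(3) by simp
  moreover have "mob X z - z = (e11 X * z + e12 X - z * (e21 X * z + e22 X)) / (e21 X * z + e22 X)"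
    using denom_pos[OF assms] by (simp add: mob_def field_simps)
  ultimately show ?thesis by simp
qed

lemma mob_less_iff:
  assumes "z > 0"
  shows "mob X z < z \<longleftrightarrow> fixpt X < z" "z < mob X z \<longleftrightarrow> z < fixpt X"
proof -
  define k where "k = e21 X * (z + fixpt (flip X)) / (e21 X * z + e22 X)"
  have k: "k > 0" using denom_pos[OF assms] pos1_entries fixpt_pos assms by (simp add: k_def)
  have e: "mob X z - z = k * (fixpt X - z)" using mob_diff_self[OF assms] by (simp add: k_def)
  have "mob X z - z < 0 \<longleftrightarrow> fixpt X - z < 0" "mob X z - z > 0 \<longleftrightarrow> fixpt X - z > 0"
    unfolding e using k by (simp_all add: mult_less_0_iff zero_less_mult_iff)
  then show "mob X z < z \<longleftrightarrow> fixpt X < z" "z < mob X z \<longleftrightarrow> z < fixpt X" by simp_all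
qed

lemma mob_fixpt: "mob X (fixpt X) = fixpt X"
  using mob_less_iff[OF fixpt_pos(1)] by (simp add: not_less_iff_gr_or_eq[symmetric] order.asym linorder_neq_iff)

lemma fixpt_unique: "z > 0 \<Longrightarrow> mob X z = z \<Longrightarrow> fixpt X = z"
  using mob_less_iff[of z] by (metis linorder_neqE less_irrefl)

text \<open>After clearing denominators the difference is \<open>det2 X * (y - x)\<close>, and the
  determinant is 1.\<close>

lemma mob_less:
  assumes "0 < x" "x < y"
  shows "mob X x < mob X y"
proof -
  have d: "e21 X * x + e22 X > 0" "e21 X * y + e22 X > 0"
    using assms by (auto intro: denom_pos)
  have "(e11 X * y + e12 X) * (e21 X * x + e22 X) - (e11 X * x + e12 X) * (e21 X * y + e22 X)
     = y - x"
    using pos1_entries(5) by Groebner_Basis.algebra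
  then show ?thesis
    using assms d by (simp add: mob_def divide_less_eq less_divide_eq field_simps)
qed

lemma mob_le: "0 < x \<Longrightarrow> x \<le> y \<Longrightarrow> mob X x \<le> mob X y"
  using mob_less[of x y] by (cases "x = y") auto

lemma form_eq_mob: "x > 0 \<Longrightarrow> form X \<eta> x = (e21 X * x + e22 X) * (mob X x + \<eta>)"
  using denom_pos[of x] by (simp add: form_def mob_def field_simps)

lemma form_fixpt: "form X \<eta> (fixpt X) = rho X * (fixpt X + \<eta>)"
  using form_eq_mob[of "fixpt X" \<eta>] fixpt_pos mob_fixpt pos1_entries by (simp add: fixpt_def)

lemma mob_mult_denom: "x > 0 \<Longrightarrow> mob X x * (e21 X * x + e22 X) = e11 X * x + e12 X"
  using denom_pos[of x] by (simp add: mob_def)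

lemma mob_mult:
  assumes "x > 0"
  shows "mob (Y * X) x = mob Y (mob X x)"
proof -
  define d where "d = e21 X * x + e22 X"
  have d: "d \<noteq> 0" using denom_pos[OF assms] by (simp add: d_def)
  have "mob Y (mob X x) = ((e11 Y * mob X x + e12 Y) * d) / ((e21 Y * mob X x + e22 Y) * d)"
    using d by (simp add: mob_def)
  also have "(e11 Y * mob X x + e12 Y) * d = e11 (Y * X) * x + e12 (Y * X)"
    using mob_mult_denom[OF assms] unfolding d_def entries_mult by Groebner_Basis.algebra
  also have "(e21 Y * mob X x + e22 Y) * d = e21 (Y * X) * x + e22 (Y * X)"
    using mob_mult_denom[OF assms] unfolding d_def entries_mult by Groebner_Basis.algebra
  finally show ?thesis by (simp add: mob_def)
qed

lemma form_mult: "x > 0 \<Longrightarrow> form (Y * X) \<eta> x = (e21 X * x + e22 X) * form Y \<eta> (mob X x)"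
  using mob_mult_denom[of x] unfolding form_def entries_mult by Groebner_Basis.algebra

text \<open>The eigenvalues of \<open>X\<close> are \<open>rho X\<close> and its inverse, so the
  trace combines their powers, with coefficients that add up to \<open>tr2 Q\<close> at
  \<open>N = 0\<close>. Here \<alpha> is the trace of \<open>Q\<close> times the spectral projection
  onto the dominant column.\<close>

lemma tr2_mult_power:
  fixes Q
  defines "\<alpha> \<equiv> form Q (fixpt (flip X)) (fixpt X) / (fixpt X + fixpt (flip X))"
  shows "tr2 (Q * X ^ N) = rho X ^ N * \<alpha> + (tr2 Q - \<alpha>) / rho X ^ N"
proof (induction N rule: less_induct)
  case (less N)
  have r: "rho X > 0" using rho_gt_1 by simp
  have c: "e21 X > 0" using pos1_entries by simp
  consider "N = 0" | "N = 1" | k where "N = Suc (Suc k)"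
    by (metis One_nat_def not0_implies_Suc)
  then show ?case
  proof cases
    case 1
    then show ?thesis by simp
  next
    case 2
    define D where "D = 2 * rho X - tr2 X"
    have D: "D > 0" using rho_gt_entries by (simp add: tr2_def D_def)
    have s: "fixpt X + fixpt (flip X) = D / e21 X"
      using c by (simp add: fixpt_def tr2_def D_def field_simps)
    have "form Q (fixpt (flip X)) (fixpt X) * e21 X
      = e11 Q * (rho X - e22 X) + e12 Q * e21 X + e22 Q * (rho X - e11 X)
        + e21 Q * ((rho X - e11 X) * (rho X - e22 X) / e21 X)"
      using c by (simp add: form_def fixpt_def field_simps)
    also have "\<dots> = e11 Q * (rho X - e22 X) + e12 Q * e21 X + e22 Q * (rho X - e11 X)
        + e21 Q * e12 X"
      using c by (simp add: rho_root')
    finally have \<alpha>: "\<alpha> * D = e11 Q * (rho X - e22 X) + e12 Q * e21 X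
        + e22 Q * (rho X - e11 X) + e21 Q * e12 X"
      using c D by (simp add: \<alpha>_def s)
    have "(rho X * rho X - 1) * \<alpha> = rho X * (\<alpha> * D)"
      using rho_root unfolding D_def by Groebner_Basis.algebra
    also have "\<dots> = rho X * tr2 (Q * X) - tr2 Q"
      using rho_root unfolding \<alpha> tr2_def entries_mult by Groebner_Basis.algebra
    finally show ?thesis
      using 2 r by (simp add: field_simps)
  next
    case 3
    \<comment> \<open>Cayley-Hamilton: both sides satisfy the same two-term recursion, so
      \<open>N = 0\<close> and \<open>N = 1\<close> determine everything.\<close>
    have CH: "tr2 (Y * (X * X)) = tr2 X * tr2 (Y * X) - tr2 Y" for Y
      using pos1_entries(5) unfolding tr2_def entries_mult by Groebner_Basis.algebra
    have "tr2 (Q * X ^ N) = tr2 X * tr2 (Q * X ^ Suc k) - tr2 (Q * X ^ k)"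
      using CH[of "Q * X ^ k"] by (simp add: 3 power_Suc2 mult.assoc del: power_Suc)
    also have "\<dots> = tr2 X * (rho X ^ Suc k * \<alpha> + (tr2 Q - \<alpha>) / rho X ^ Suc k)
        - (rho X ^ k * \<alpha> + (tr2 Q - \<alpha>) / rho X ^ k)"
      using less[of "Suc k"] less[of k] 3 by simp
    also have "\<dots> = (tr2 X * rho X - 1) * rho X ^ k * \<alpha>
        + (tr2 X * rho X - rho X * rho X) * ((tr2 Q - \<alpha>) / rho X ^ N)"
      using r 3 by (simp add: field_simps)
    also have "\<dots> = rho X ^ N * \<alpha> + (tr2 Q - \<alpha>) / rho X ^ N"
    proof -
      have "tr2 X * rho X - 1 = rho X * rho X" "tr2 X * rho X - rho X * rho X = 1"
        using rho_root by simp_all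
      then show ?thesis by (simp only:) (simp add: 3)
    qed
    finally show ?thesis .
  qed
qed

end

lemma pos1_power: "pos1 X \<Longrightarrow> N > 0 \<Longrightarrow> pos1 (X ^ N)"
proof (induction N)
  case (Suc N)
  then show ?case by (cases "N = 0") (auto intro: pos1_mult)
qed simp

lemma rho_mono_tr2:
  assumes "pos1 X" "tr2 X < tr2 Y"
  shows "rho X < rho Y"
proof -
  have "2 < tr2 X" using assms(1) by (rule tr2_gt_2)
  then have "(tr2 X)\<^sup>2 - 4 < (tr2 Y)\<^sup>2 - 4"
    using assms(2) by (intro diff_strict_right_mono power_strict_mono) auto
  then have "sqrt ((tr2 X)\<^sup>2 - 4) < sqrt ((tr2 Y)\<^sup>2 - 4)"
    by (rule real_sqrt_less_mono)
  then show ?thesis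
    unfolding rho_def using assms(2) by (intro divide_strict_right_mono add_strict_mono) auto
qed

text \<open>\<open>r\<close> and \<open>rho X\<close> solve one quadratic whose roots are mutually
  inverse, and only one root exceeds 1.\<close>

lemma rho_eqI:
  assumes "pos1 X" "r > 1" "tr2 X = r + 1 / r"
  shows "rho X = r"
proof -
  have "r * r - (rho X + 1 / rho X) * r + 1 = 0"
    using assms tr2_eq_rho[OF assms(1)] by (simp add: field_simps)
  then have "(r - rho X) * (rho X * r - 1) = 0"
    using rho_gt_1[OF assms(1)] by (simp add: field_simps)
  moreover have "rho X * r > 1"
    using rho_gt_1[OF assms(1)] assms(2) by (simp add: less_1_mult)
  ultimately show ?thesis by simp
qed

lemma rho_power:
  assumes "pos1 X" "N > 0"
  shows "rho (X ^ N) = rho X ^ N"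
proof (rule rho_eqI)
  have x: "fixpt X + fixpt (flip X) > 0" using fixpt_pos[OF assms(1)] by simp
  have "form 1 (fixpt (flip X)) (fixpt X) / (fixpt X + fixpt (flip X)) = 1"
    using x by (simp add: form_def)
  then show "tr2 (X ^ N) = rho X ^ N + 1 / rho X ^ N"
    using tr2_mult_power[OF assms(1), of 1 N] by (simp add: tr2_def)
qed (use assms rho_gt_1 in \<open>auto intro: pos1_power one_less_power\<close>)

section \<open>Coding of rotations\<close>

text \<open>Here \<open>L\<close> marks an upper part of \<open>P\<close> that \<open>n\<close> moves below the image of the lower part, so \<open>n\<close> acts on
  ranks as a rotation. Ties of \<open>Y\<close> are handled by counting: they could only make the ranks fall short
  in total, whereas \<open>n\<close> permutes \<open>P\<close>.\<close>

lemma rank_shift: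
  fixes Y :: "'a \<Rightarrow> real" and L :: "'a \<Rightarrow> bool"
  assumes fin: "finite P" and bij: "bij_betw n P P"
    and above: "\<And>p q. p \<in> P \<Longrightarrow> q \<in> P \<Longrightarrow> L p \<Longrightarrow> \<not> L q \<Longrightarrow> Y q \<le> Y p"
    and mono: "\<And>p q. p \<in> P \<Longrightarrow> q \<in> P \<Longrightarrow> L p = L q \<Longrightarrow> Y (n p) < Y (n q) \<longleftrightarrow> Y p < Y q"
    and swap: "\<And>p q. p \<in> P \<Longrightarrow> q \<in> P \<Longrightarrow> L p \<Longrightarrow> \<not> L q \<Longrightarrow> Y (n p) < Y (n q)"
  defines "F \<equiv> \<lambda>p. card {r \<in> P. Y r < Y p}" and "a \<equiv> card {r \<in> P. L r}"
  assumes p: "p \<in> P"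
  shows "F (n p) + (if L p then card P else 0) = F p + a" "L p \<longleftrightarrow> card P - a \<le> F p"
proof -
  define b where "b = card {r \<in> P. \<not> L r}"
  define G where "G = (\<lambda>p. card {r \<in> P. \<not> L r \<and> Y r < Y p})"
  have "card ({r \<in> P. L r} \<union> {r \<in> P. \<not> L r}) = a + b"
    unfolding a_def b_def using fin by (intro card_Un_disjoint) auto
  moreover have "{r \<in> P. L r} \<union> {r \<in> P. \<not> L r} = P" by auto
  ultimately have N: "card P = a + b" by simp
  have image: "F (n q) = card {r \<in> P. Y (n r) < Y (n q)}" if "q \<in> P" for q
  proof -
    have "bij_betw n {r \<in> P. Y (n r) < Y (n q)} {r \<in> P. Y r < Y (n q)}"
    proof (rule bij_betw_imageI)
      show "inj_on n {r \<in> P. Y (n r) < Y (n q)}"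
        using bij by (auto simp: bij_betw_def intro: inj_on_subset)
      show "n ` {r \<in> P. Y (n r) < Y (n q)} = {r \<in> P. Y r < Y (n q)}"
        using bij by (auto simp: bij_betw_def)
    qed
    then show ?thesis unfolding F_def by (simp add: bij_betw_same_card)
  qed
  have F_lower: "F q = G q" if "q \<in> P" "\<not> L q" for q
    unfolding F_def G_def using above[OF _ that(1) _ that(2)]
    by (intro arg_cong[where f = card]) force
  have shift_lower: "F (n q) = F q + a" if q: "q \<in> P" "\<not> L q" for q
  proof -
    have "{r \<in> P. Y (n r) < Y (n q)} = {r \<in> P. L r} \<union> {r \<in> P. \<not> L r \<and> Y r < Y q}"
      using mono[OF _ q(1)] swap[OF _ q(1) _ q(2)] q(2) by auto
    moreover have "card ({r \<in> P. L r} \<union> {r \<in> P. \<not> L r \<and> Y r < Y q}) = a + G q"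
      unfolding a_def G_def using fin by (intro card_Un_disjoint) auto
    ultimately show ?thesis using image[OF q(1)] F_lower[OF q] by simp
  qed
  have shift_upper: "F (n q) + G q = F q" if q: "q \<in> P" "L q" for q
  proof -
    have "{r \<in> P. Y (n r) < Y (n q)} = {r \<in> P. L r \<and> Y r < Y q}"
      using mono[OF _ q(1)] swap[OF q(1) _ q(2)] q(2) by (auto simp: not_less order.strict_implies_order dest: order.asym)
    moreover have "F q = card ({r \<in> P. L r \<and> Y r < Y q} \<union> {r \<in> P. \<not> L r \<and> Y r < Y q})"
      unfolding F_def by (intro arg_cong[where f = card]) auto
    moreover have "\<dots> = card {r \<in> P. L r \<and> Y r < Y q} + G q"
      unfolding G_def using fin by (intro card_Un_disjoint) auto
    ultimately show ?thesis using image[OF q(1)] by simp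
  qed
  have G_le: "G q \<le> b" for q
    unfolding G_def b_def using fin by (intro card_mono) auto
  have "P \<inter> {r. L r} = {r \<in> P. L r}" "P \<inter> - {r. L r} = {r \<in> P. \<not> L r}" by auto
  then have two_valued: "(\<Sum>q\<in>P. if L q then c else d) = a * c + b * d" for c d
    unfolding a_def b_def sum.If_cases[OF fin] by simp
  have "(\<Sum>q\<in>P. F (n q)) = (\<Sum>q\<in>P. F q)"
    using sum.reindex_bij_betw[OF bij] .
  moreover have "F (n q) + (if L q then G q else 0) = F q + (if L q then 0 else a)" if "q \<in> P" for q
    using shift_lower shift_upper that by simp
  then have "(\<Sum>q\<in>P. F (n q) + (if L q then G q else 0)) = (\<Sum>q\<in>P. F q + (if L q then 0 else a))"
    by (rule sum.cong[OF refl])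
  then have "(\<Sum>q\<in>P. F (n q)) + (\<Sum>q\<in>P. if L q then G q else 0)
      = (\<Sum>q\<in>P. F q) + (\<Sum>q\<in>P. if L q then 0 else a)"
    by (simp only: sum.distrib)
  ultimately have "(\<Sum>q\<in>P. if L q then G q else 0) = (\<Sum>q\<in>P. if L q then 0 else a)"
    by (simp only: add_left_cancel)
  also have "\<dots> = b * a"
    by (simp only: two_valued mult_0_right add_0)
  also have "\<dots> = (\<Sum>q\<in>P. if L q then b else 0)"
    by (simp only: two_valued mult_0_right add_0_right mult.commute)
  \<comment> \<open>The sums agree while \<open>G q \<le> b\<close> holds termwise, so equality
    holds for each upper element: the whole lower part lies strictly below it, without ties.\<close>
  finally have "(if L q then G q else 0) = (if L q then b else 0)" if "q \<in> P" for q
    using fin G_le that by (intro sum_mono_inv[of "\<lambda>q. if L q then G q else 0" P]) auto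
  then have G_eq: "G q = b" if "q \<in> P" "L q" for q
    using that by (metis (full_types))
  show "F (n p) + (if L p then card P else 0) = F p + a"
    using shift_lower[OF p] shift_upper[OF p] G_eq[OF p] N by auto
  show "L p \<longleftrightarrow> card P - a \<le> F p"
  proof (cases "L p")
    case True
    then show ?thesis using shift_upper[OF p] G_eq[OF p] N by simp
  next
    case False
    have "G p < b"
      unfolding G_def b_def using fin p False by (intro psubset_card_mono) auto
    then show ?thesis using F_lower[OF p] False N by simp
  qed
qed

text \<open>For \<open>k \<le> m\<close> this codes the orbit of 0 under addition of
  \<open>k\<close> modulo \<open>m\<close>: the letter at time \<open>t\<close> is
  \<open>True\<close> exactly when the next addition wraps around.\<close>

definition christoffel :: "nat \<Rightarrow> nat \<Rightarrow> bool list" where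
  "christoffel m k = map (\<lambda>t. m - k \<le> t * k mod m) [0..<m]"

lemma length_christoffel [simp]: "length (christoffel m k) = m"
  by (simp add: christoffel_def)

lemma concat_replicate_map_upt:
  assumes "\<And>t. f (t + m) = f t"
  shows "concat (replicate c (map f [0..<m])) = map f [0..<c * m]"
proof (induction c)
  case (Suc c)
  have "f (t + c * m) = f t" for t
  proof (induction c)
    case (Suc c)
    then show ?case using assms[of "t + c * m"] by (simp add: ac_simps)
  qed simp
  then have "map f [c * m..<c * m + m] = map f [0..<m]"
    by (intro nth_equalityI) (simp_all add: add.commute)
  then have "map f [0..<Suc c * m] = concat (replicate c (map f [0..<m])) @ map f [0..<m]"
    using Suc upt_add_eq_append[of 0 "c * m" m] by (simp add: add.commute)
  also have "\<dots> = concat (replicate (Suc c) (map f [0..<m]))"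
    by (simp add: replicate_append_same[symmetric] del: replicate_append_same)
  finally show ?case ..
qed simp

text \<open>A factor \<open>c\<close> in both \<open>m\<close> and \<open>k\<close> scales residues
  and threshold alike, so no letter changes; the letters have period \<open>m\<close>.\<close>

lemma concat_replicate_christoffel:
  assumes "c > 0"
  shows "concat (replicate c (christoffel m k)) = christoffel (c * m) (c * k)"
proof -
  have "(m - k \<le> t * k mod m) \<longleftrightarrow> (c * m - c * k \<le> t * (c * k) mod (c * m))" for t
  proof -
    have "t * (c * k) mod (c * m) = c * (t * k mod m)"
      by (metis mult.left_commute mult_mod_right)
    then show ?thesis using assms by (simp flip: diff_mult_distrib2)
  qed
  moreover have "(m - k \<le> (t + m) * k mod m) \<longleftrightarrow> (m - k \<le> t * k mod m)" for t
    by (simp add: add_mult_distrib)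
  ultimately show ?thesis
    unfolding christoffel_def by (subst concat_replicate_map_upt) (simp_all add: mult.commute)
qed

lemma christoffel_same_slope:
  assumes "0 < m" "0 < m'" "m * k' = m' * k"
  shows "concat (replicate m' (christoffel m k)) = concat (replicate m (christoffel m' k'))"
  using assms by (simp add: concat_replicate_christoffel mult.commute)

text \<open>The circle rotation lifted to the integers: each letter \<open>True\<close> records one
  wrap by \<open>N\<close>, and counting these letters undoes the reductions.\<close>

lemma rank_rotate:
  fixes F :: "bool list \<Rightarrow> nat"
  assumes step: "\<And>v. v \<in> P \<Longrightarrow> F (rotate1 v) + (if hd v then N else 0) = F v + a"
    and P: "\<And>v. v \<in> P \<Longrightarrow> rotate1 v \<in> P" and w: "w \<in> P"
    and t: "t \<le> length w"
  shows "F (rotate t w) + N * count_list (take t w) True = F w + t * a \<and> rotate t w \<in> P"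
  using t
proof (induction t)
  case 0
  then show ?case using w by simp
next
  case (Suc t)
  then have IH: "F (rotate t w) + N * count_list (take t w) True = F w + t * a" "rotate t w \<in> P"
    by auto
  have "hd (rotate t w) = w ! t"
    using Suc.prems by (subst hd_rotate_conv_nth) auto
  then have "F (rotate (Suc t) w) + (if w ! t then N else 0) = F (rotate t w) + a"
    using step[OF IH(2)] by simp
  then show ?case
    using IH P Suc.prems by (auto simp: take_Suc_conv_app_nth algebra_simps)
qed

text \<open>After \<open>length w\<close> rotations the word is back, so the ranks on both sides of
  the lifted equation cancel.\<close>

lemma rotation_number:
  fixes F :: "bool list \<Rightarrow> nat"
  assumes "\<And>v. v \<in> P \<Longrightarrow> F (rotate1 v) + (if hd v then N else 0) = F v + a"
    and "\<And>v. v \<in> P \<Longrightarrow> rotate1 v \<in> P" and "w \<in> P"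
  shows "N * count_list w True = length w * a"
  using rank_rotate[OF assms, of "length w"] by simp

text \<open>Starting from rank 0, the rank after \<open>t\<close> rotations is
  \<open>t * a mod N\<close>. The slope identity then trades the pair \<open>(N, a)\<close> for
  length and letter count; scaling both sides of the comparison avoids reducing either fraction to
  lowest terms.\<close>

lemma eq_christoffel:
  fixes F :: "bool list \<Rightarrow> nat"
  assumes step: "\<And>v. v \<in> P \<Longrightarrow> F (rotate1 v) + (if hd v then N else 0) = F v + a"
    and hd: "\<And>v. v \<in> P \<Longrightarrow> hd v \<longleftrightarrow> N - a \<le> F v" and less: "\<And>v. v \<in> P \<Longrightarrow> F v < N"
    and P: "\<And>v. v \<in> P \<Longrightarrow> rotate1 v \<in> P" and w: "w \<in> P" and F0: "F w = 0"
  shows "w = christoffel (length w) (count_list w True)"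
proof (rule nth_equalityI)
  let ?m = "length w" and ?k = "count_list w True"
  have slope: "N * ?k = ?m * a" by (rule rotation_number[OF step P w])
  have N: "N > 0" using less[OF w] by simp
  fix t assume t: "t < ?m"
  have r: "F (rotate t w) + N * count_list (take t w) True = t * a" "rotate t w \<in> P"
    using rank_rotate[OF step P w, of t] t F0 by auto
  have w0: "w \<noteq> []" using t by auto
  have "F (rotate t w) = t * a mod N"
    using r less[OF r(2)] by (metis mod_less mod_mult_self2)
  then have "w ! t \<longleftrightarrow> N - a \<le> t * a mod N"
    using hd[OF r(2)] hd_rotate_conv_nth[OF w0, of t] t by simp
  also have "\<dots> \<longleftrightarrow> ?m * (N - a) \<le> ?m * (t * a mod N)"
    by (rule nat_mult_le_cancel1[symmetric]) (use w0 in simp)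
  also have "\<dots> \<longleftrightarrow> N * (?m - ?k) \<le> N * (t * ?k mod ?m)"
  proof -
    have "?m * (N - a) = N * (?m - ?k)"
      unfolding diff_mult_distrib2 slope by (simp only: mult.commute)
    moreover have "?m * (t * a mod N) = t * (?m * a) mod (?m * N)"
      by (simp only: mult_mod_right mult.left_commute)
    then have "?m * (t * a mod N) = N * (t * ?k mod ?m)"
      by (simp only: mult_mod_right mult.left_commute slope[symmetric] mult.commute[of ?m N])
    ultimately show ?thesis by simp
  qed
  also have "\<dots> \<longleftrightarrow> ?m - ?k \<le> t * ?k mod ?m"
    by (rule nat_mult_le_cancel1) (rule N)
  finally show "w ! t = christoffel ?m ?k ! t"
    using t by (simp add: christoffel_def)
qed simp

section \<open>Countable closed partitions of intervals\<close>

text \<open>Take the last point \<open>z\<close> of \<open>S\<close> before \<open>p\<close>. Points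
  between \<open>z\<close> and \<open>p\<close> are outside \<open>S\<close>, and those close enough
  to \<open>z\<close> are also outside \<open>T\<close>, since \<open>T\<close> is closed and misses
  \<open>z\<close>.\<close>

lemma separate_right:
  fixes p q :: real
  assumes "closed S" "closed T" "S \<inter> T = {}" "q \<in> S" "p \<in> T" "q < p"
  obtains y where "q < y" "y < p" "y \<notin> T" "{y..p} \<inter> S = {}"
proof -
  have "compact (S \<inter> {q..p})"
    using assms(1) by (subst Int_commute) (intro compact_Int_closed compact_Icc)
  moreover have "S \<inter> {q..p} \<noteq> {}"
    using assms by auto
  ultimately obtain z where "z \<in> S \<inter> {q..p}" and max: "\<And>x. x \<in> S \<inter> {q..p} \<Longrightarrow> x \<le> z"
    using compact_attains_sup by metis
  then have z: "z \<in> S" "q \<le> z" "z < p"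
    using assms by (auto simp: order.order_iff_strict)
  have above: "x \<notin> S" if "z < x" "x \<le> p" for x
    using max[of x] that z by force
  have "open (- T)" "z \<in> - T" using assms z by auto
  then obtain e where e: "e > 0" "\<And>x. dist x z < e \<Longrightarrow> x \<notin> T"
    by (metis Compl_iff open_dist)
  define d where "d = min (e / 2) ((p - z) / 2)"
  have "d \<le> e / 2" "d \<le> (p - z) / 2"
    unfolding d_def by (rule min.cobounded1, rule min.cobounded2)
  then have d: "0 < d" "d < e" "z + d < p"
    using e(1) z(3) by (auto simp: d_def field_simps)
  show thesis
  proof (rule that[of "z + d"])
    show "z + d \<notin> T"
      using d by (intro e(2)) (simp add: dist_real_def)
  qed (use z d above in auto)
qed

lemma separate_left:
  fixes p q :: real
  assumes "closed S" "closed T" "S \<inter> T = {}" "q \<in> S" "p \<in> T" "p < q"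
  obtains y where "p < y" "y < q" "y \<notin> T" "{p..y} \<inter> S = {}"
proof -
  have "uminus ` A = uminus -` A" for A :: "real set"
    by (auto simp: image_iff) (metis minus_minus)
  then have "closed (uminus ` S)" "closed (uminus ` T)"
    using assms(1,2) closed_vimage[of _ "uminus :: real \<Rightarrow> real"]
    by (simp_all add: continuous_on_minus)
  moreover have "uminus ` S \<inter> uminus ` T = {}" using assms by auto
  ultimately obtain y where y: "- q < y" "y < - p" "y \<notin> uminus ` T" "{y..-p} \<inter> uminus ` S = {}"
    by (rule separate_right[of "uminus ` S" "uminus ` T" "- q" "- p"]) (use assms in auto)
  show thesis
  proof (rule that[of "- y"])
    show "- y \<notin> T" using y(3) by (metis imageI minus_minus)
    have "x \<notin> S" if "p \<le> x" "x \<le> - y" for x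
    proof
      assume "x \<in> S"
      then have "- x \<in> {y..-p} \<inter> uminus ` S" using that by auto
      then show False using y(4) by simp
    qed
    then show "{p..- y} \<inter> S = {}" by auto
  qed (use y in auto)
qed

text \<open>Sierpinski's theorem on decompositions of continua, for intervals.\<close>

lemma interval_countable_closed_partition:
  fixes a b :: real
  assumes "countable \<F>" and cl: "\<And>S. S \<in> \<F> \<Longrightarrow> closed S"
    and disj: "\<And>S T. S \<in> \<F> \<Longrightarrow> T \<in> \<F> \<Longrightarrow> S \<noteq> T \<Longrightarrow> S \<inter> T = {}"
    and cover: "{a..b} \<subseteq> \<Union>\<F>" and "a \<le> b"
  shows "\<exists>S\<in>\<F>. {a..b} \<subseteq> S"
proof (rule ccontr)
  assume neg: "\<not> (\<exists>S\<in>\<F>. {a..b} \<subseteq> S)"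
  \<comment> \<open>The intervals that no single member contains. Each can be shrunk within this
    class so as to avoid a prescribed member; doing so for every member in turn leaves a point of
    \<open>{a..b}\<close> that none covers.\<close>
  define Q where "Q = (\<lambda>c d. c \<le> d \<and> a \<le> c \<and> d \<le> b \<and> (\<forall>S\<in>\<F>. \<not> {c..d} \<subseteq> S))"
  have QD: "c \<le> d" "a \<le> c" "d \<le> b" "\<And>S. S \<in> \<F> \<Longrightarrow> \<not> {c..d} \<subseteq> S" if "Q c d" for c d
    using that by (auto simp: Q_def)
  have step: "\<exists>c' d'. Q c' d' \<and> c \<le> c' \<and> d' \<le> d \<and> {c'..d'} \<inter> S = {}"
    if I: "Q c d" and S: "S \<in> \<F>" for c d S
  proof (cases "{c..d} \<inter> S = {}")
    case True
    then show ?thesis using I by blast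
  next
    case False
    then obtain q where q: "q \<in> S" "c \<le> q" "q \<le> d" by auto
    obtain p where p: "p \<notin> S" "c \<le> p" "p \<le> d"
      using QD(4)[OF I S] by (meson atLeastAtMost_iff subsetI)
    have "p \<in> {a..b}" using QD(2,3)[OF I] p by simp
    then obtain T where T: "T \<in> \<F>" "p \<in> T" using cover by blast
    have ST: "S \<inter> T = {}" using disj[OF S T(1)] p(1) T(2) by blast
    \<comment> \<open>By disjointness the only member through \<open>p\<close> is \<open>T\<close>,
      so an interval that also holds a point \<open>y\<close> outside \<open>T\<close> fits into no
      member.\<close>
    have Q: "Q c' d'"
      if "c \<le> c'" "d' \<le> d" "c' \<le> p" "p \<le> d'" "y \<in> {c'..d'}" "y \<notin> T" for c' d' y
    proof -
      have "\<not> {c'..d'} \<subseteq> U" if "U \<in> \<F>" for U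
      proof
        assume U: "{c'..d'} \<subseteq> U"
        have "p \<in> U" "y \<in> U" using U \<open>c' \<le> p\<close> \<open>p \<le> d'\<close> \<open>y \<in> {c'..d'}\<close> by auto
        then show False using disj[OF T(1) that] T(2) \<open>y \<notin> T\<close> by blast
      qed
      then show ?thesis using that QD(1-3)[OF I] unfolding Q_def by auto
    qed
    show ?thesis
    proof (cases "q < p")
      case True
      obtain y where y: "q < y" "y < p" "y \<notin> T" "{y..p} \<inter> S = {}"
        using separate_right[OF cl[OF S] cl[OF T(1)] ST q(1) T(2) True] .
      then have "Q y p" using Q[of y p y] q p by simp
      then show ?thesis using y q p by (intro exI[of _ y] exI[of _ p]) simp
    next
      case False
      have "p \<noteq> q" using p(1) q(1) by blast
      then have "p < q" using False by simp
      obtain y where y: "p < y" "y < q" "y \<notin> T" "{p..y} \<inter> S = {}"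
        using separate_left[OF cl[OF S] cl[OF T(1)] ST q(1) T(2) \<open>p < q\<close>] .
      then have "Q p y" using Q[of p y y] q p by simp
      then show ?thesis using y q p by (intro exI[of _ p] exI[of _ y]) simp
    qed
  qed
  have "\<F> \<noteq> {}" using cover \<open>a \<le> b\<close> by auto
  define G where "G = from_nat_into \<F>"
  have G: "G n \<in> \<F>" for n
    unfolding G_def using \<open>\<F> \<noteq> {}\<close> by (rule from_nat_into)
  have "\<exists>I. \<forall>n. Q (fst (I n)) (snd (I n)) \<and>
      fst (I n) \<le> fst (I (Suc n)) \<and> snd (I (Suc n)) \<le> snd (I n) \<and>
      {fst (I (Suc n))..snd (I (Suc n))} \<inter> G n = {}"
  proof -
    have "Q a b" using neg \<open>a \<le> b\<close> by (auto simp: Q_def)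
    then show ?thesis
      using dependent_nat_choice[of "\<lambda>n I. Q (fst I) (snd I)" "\<lambda>n I J. fst I \<le> fst J \<and>
          snd J \<le> snd I \<and> {fst J..snd J} \<inter> G n = {}"] step[OF _ G]
      by (metis fst_conv snd_conv)
  qed
  then obtain I where QI: "\<And>n. Q (fst (I n)) (snd (I n))"
    and I_Suc: "\<And>n. fst (I n) \<le> fst (I (Suc n))" "\<And>n. snd (I (Suc n)) \<le> snd (I n)"
      "\<And>n. {fst (I (Suc n))..snd (I (Suc n))} \<inter> G n = {}"
    by blast
  have mono: "incseq (\<lambda>n. fst (I n))" "decseq (\<lambda>n. snd (I n))"
    using I_Suc by (auto intro: incseq_SucI decseq_SucI)
  have le: "fst (I n) \<le> snd (I m)" for n m
  proof -
    have "fst (I n) \<le> fst (I (max n m))" using mono(1) by (auto simp: incseq_def)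
    also have "\<dots> \<le> snd (I (max n m))" by (rule QD(1)[OF QI])
    also have "\<dots> \<le> snd (I m)" using mono(2) by (auto simp: decseq_def)
    finally show ?thesis .
  qed
  define x where "x = (SUP n. fst (I n))"
  have x: "fst (I n) \<le> x" "x \<le> snd (I n)" for n
    unfolding x_def using le by (auto intro!: cSUP_upper cSUP_least bdd_aboveI2)
  have "x \<in> {a..b}" using x[of 0] QD(2,3)[OF QI[of 0]] by simp
  then obtain S where S: "S \<in> \<F>" "x \<in> S" using cover by auto
  obtain n where "G n = S"
    using from_nat_into_surj[OF \<open>countable \<F>\<close> S(1)] by (auto simp: G_def)
  then show False using I_Suc(3)[of n] x[of "Suc n"] S(2) by auto
qed

section \<open>Maximizing words\<close>

lemma mob_less_cancel:
  assumes "pos1 X" "0 < x" "0 < y"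
  shows "mob X x < mob X y \<longleftrightarrow> x < y"
  using mob_less[OF assms(1)] assms(2,3) by (metis linorder_neqE order.asym less_irrefl)

definition word_mat :: "m2 \<Rightarrow> m2 \<Rightarrow> bool list \<Rightarrow> m2" where
  "word_mat A B w = prod_list (map (\<lambda>b. if b then A else B) w)"

lemma word_mat_simps [simp]:
  "word_mat A B [] = 1"
  "word_mat A B (b # w) = (if b then A else B) * word_mat A B w"
  "word_mat A B (v @ w) = word_mat A B v * word_mat A B w"
  by (simp_all add: word_mat_def)

lemma word_mat_concat_replicate: "word_mat A B (concat (replicate n w)) = word_mat A B w ^ n"
  by (induction n) simp_all

lemma word_mat_flip: "word_mat (flip A) (flip B) (rev w) = flip (word_mat A B w)"
  by (induction w) (simp_all add: flip_mult)

text \<open>Compares the normalised radii, the \<open>length\<close>-th roots of \<open>rho\<close>,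
  with the roots cleared, so that each competitor contributes one inequality between powers.\<close>

definition optimal :: "m2 \<Rightarrow> m2 \<Rightarrow> bool list \<Rightarrow> bool" where
  "optimal A B w \<longleftrightarrow> w \<noteq> [] \<and>
     (\<forall>v. v \<noteq> [] \<longrightarrow> rho (word_mat A B v) ^ length w \<le> rho (word_mat A B w) ^ length v)"

locale positive_pair =
  fixes A B :: m2
  assumes pos1_A: "pos1 A" and pos1_B: "pos1 B"
begin

abbreviation M where "M \<equiv> word_mat A B"

definition colfix :: "bool list \<Rightarrow> real" where
  "colfix w = fixpt (M w)"

definition rowfix :: "bool list \<Rightarrow> real" where
  "rowfix w = fixpt (flip (M w))"

lemma pos1_letter: "pos1 (if b then A else B)"
  using pos1_A pos1_B by simp

lemma pos1_M: "w \<noteq> [] \<Longrightarrow> pos1 (M w)"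
proof (induction w rule: list_nonempty_induct)
  case (single b)
  then show ?case using pos1_letter[of b] by simp
next
  case (cons b w)
  then show ?case using pos1_mult[OF pos1_letter[of b]] by simp
qed

lemma col_row_pos: "w \<noteq> [] \<Longrightarrow> colfix w > 0" "w \<noteq> [] \<Longrightarrow> rowfix w > 0"
  using fixpt_pos[OF pos1_M] by (simp_all add: colfix_def rowfix_def)

text \<open>Since \<open>M (p @ z) * M p = M p * M (z @ p)\<close>, the action of \<open>M p\<close>
  carries the fixed point of one rotation to a fixed point of the other.\<close>

lemma col_rotate:
  assumes "p \<noteq> []" "z \<noteq> []"
  shows "mob (M p) (colfix (z @ p)) = colfix (p @ z)"
proof -
  have pos: "pos1 (M p)" "pos1 (M z)" "pos1 (M (p @ z))" "pos1 (M (z @ p))"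
    using assms by (auto intro!: pos1_M simp del: word_mat_simps)
  have c: "colfix (z @ p) > 0" using assms by (simp add: col_row_pos)
  have "mob (M (p @ z)) (mob (M p) (colfix (z @ p))) = mob (M p) (mob (M z) (mob (M p) (colfix (z @ p))))"
    using mob_mult[OF pos(2) mob_pos[OF pos(1) c]] by simp
  also have "mob (M z) (mob (M p) (colfix (z @ p))) = mob (M (z @ p)) (colfix (z @ p))"
    using mob_mult[OF pos(1) c] by simp
  also have "\<dots> = colfix (z @ p)"
    unfolding colfix_def by (rule mob_fixpt[OF pos(4)])
  finally show ?thesis
    using fixpt_unique[OF pos(3) mob_pos[OF pos(1) c]] by (simp add: colfix_def)
qed

lemma optimal_nonempty: "optimal A B w \<Longrightarrow> w \<noteq> []"
  by (simp add: optimal_def)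

lemma optimal_rotate: "optimal A B (p @ z) \<Longrightarrow> optimal A B (z @ p)"
  by (auto simp: optimal_def rho_commute[of "M p"] add.commute)

lemma optimal_rotate1: "optimal A B w \<Longrightarrow> optimal A B (rotate1 w)"
  using optimal_rotate[of "[hd w]" "tl w"] by (cases w) auto

lemma optimal_concat_replicate:
  assumes "n > 0"
  shows "optimal A B (concat (replicate n w)) \<longleftrightarrow> optimal A B w"
proof (cases "w = []")
  case False
  have len: "length (concat (replicate n w)) = n * length w"
    by (induction n) simp_all
  have r: "rho (M (concat (replicate n w))) = rho (M w) ^ n"
    using False assms by (simp add: word_mat_concat_replicate rho_power pos1_M)
  have "rho (M v) ^ (n * length w) \<le> (rho (M w) ^ n) ^ length v
      \<longleftrightarrow> rho (M v) ^ length w \<le> rho (M w) ^ length v" if "v \<noteq> []" for v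
  proof -
    have "rho (M v) > 1" "rho (M w) > 1"
      using that False by (auto intro: rho_gt_1 pos1_M)
    moreover have "rho (M v) ^ (n * length w) = (rho (M v) ^ length w) ^ n"
      "(rho (M w) ^ n) ^ length v = (rho (M w) ^ length v) ^ n"
      by (simp_all add: power_mult[symmetric] mult.commute)
    ultimately show ?thesis using assms by (simp add: power_mono_iff)
  qed
  moreover have "concat (replicate n w) \<noteq> []" using False assms by (cases n) auto
  ultimately show ?thesis using False by (auto simp: optimal_def len r)
qed (auto simp: optimal_def)

text \<open>The words consisting of \<open>v\<close> followed by \<open>N\<close> copies of
  \<open>w\<close> cannot grow faster than \<open>R\<close> per letter, while their traces grow like
  \<open>r ^ N * \<alpha>\<close>. Comparing leading coefficients for large \<open>N\<close> gives
  the bound.\<close>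

lemma form_optimal_le:
  assumes w: "optimal A B w" and R: "R > 0" "R ^ length w = rho (M w)"
  shows "form (M v) (rowfix w) (colfix w) \<le> R ^ length v * (colfix w + rowfix w)"
proof (rule ccontr)
  have pw: "pos1 (M w)" using w by (intro pos1_M optimal_nonempty)
  define r where "r = rho (M w)"
  have r: "r > 1" unfolding r_def by (rule rho_gt_1[OF pw])
  define \<alpha> where "\<alpha> = form (M v) (rowfix w) (colfix w) / (colfix w + rowfix w)"
  have cr: "colfix w + rowfix w > 0"
    using col_row_pos[OF optimal_nonempty[OF w]] by simp
  assume "\<not> ?thesis"
  then have \<alpha>: "\<alpha> - R ^ length v > 0" using cr by (simp add: \<alpha>_def field_simps)
  \<comment> \<open>Collects the bounded terms: 1 for the inverse of \<open>rho (M u)\<close>, the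
    absolute value for the coefficient of the decaying power.\<close>
  define c where "c = 1 + \<bar>tr2 (M v) - \<alpha>\<bar>"
  have bound: "r ^ N * (\<alpha> - R ^ length v) \<le> c" if N: "N > 0" for N
  proof -
    define u where "u = v @ concat (replicate N w)"
    have u: "u \<noteq> []" using N optimal_nonempty[OF w] by (cases N) (auto simp: u_def)
    have "length u = length v + N * length w"
      unfolding u_def by (induction N) simp_all
    then have Ru: "R ^ length u = R ^ length v * r ^ N"
      by (simp add: power_add power_mult mult.commute[of N] R(2) r_def)
    have "rho (M u) ^ length w \<le> r ^ length u"
      using w u by (auto simp: optimal_def r_def)
    also have "\<dots> = (R ^ length u) ^ length w"
      unfolding r_def R(2)[symmetric] by (simp add: power_mult[symmetric] mult.commute)
    finally have rho_u: "rho (M u) \<le> R ^ length u"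
      using R(1) optimal_nonempty[OF w] by (simp add: power_mono_iff rho_gt_1[OF pos1_M[OF u], THEN less_imp_le, THEN order.trans[rotated]])
    have "r ^ N * \<alpha> + (tr2 (M v) - \<alpha>) / r ^ N = tr2 (M u)"
      using tr2_mult_power[OF pw, of "M v" N]
      by (simp add: u_def word_mat_concat_replicate \<alpha>_def r_def colfix_def rowfix_def)
    also have "\<dots> = rho (M u) + 1 / rho (M u)"
      by (rule tr2_eq_rho[OF pos1_M[OF u]])
    also have "\<dots> \<le> R ^ length v * r ^ N + 1"
      using rho_u rho_gt_1[OF pos1_M[OF u]] unfolding Ru by (intro add_mono) auto
    finally have "r ^ N * (\<alpha> - R ^ length v) \<le> 1 - (tr2 (M v) - \<alpha>) / r ^ N"
      by (simp add: algebra_simps)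
    also have "\<dots> \<le> 1 + \<bar>tr2 (M v) - \<alpha>\<bar> / r ^ N"
      using r by (simp add: minus_divide_left divide_right_mono)
    also have "\<dots> \<le> c"
      unfolding c_def using r one_le_power[of r N]
      by (simp add: divide_le_eq mult_le_cancel_left1)
    finally show ?thesis .
  qed
  obtain N where "c / (\<alpha> - R ^ length v) < r ^ N" using real_arch_pow[OF r] by blast
  then have "c < r ^ N * (\<alpha> - R ^ length v)" using \<alpha> by (simp add: field_simps)
  also have "\<dots> \<le> r ^ Suc N * (\<alpha> - R ^ length v)"
    using r \<alpha> by (intro mult_right_mono power_increasing) auto
  finally show False using bound[of "Suc N"] by simp
qed

lemma optimal_growth_rate:
  assumes "optimal A B w"
  obtains R where "R > 0" "\<And>v. optimal A B v \<Longrightarrow> R ^ length v = rho (M v)"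
proof -
  define R where "R = root (length w) (rho (M w))"
  have w: "length w > 0" "rho (M w) > 1"
    using assms by (auto simp: optimal_def intro: rho_gt_1 pos1_M)
  have R: "R > 0" "R ^ length w = rho (M w)"
    using w by (simp_all add: R_def)
  have "R ^ length v = rho (M v)" if "optimal A B v" for v
  proof -
    have v: "length v > 0" "rho (M v) > 1"
      using that by (auto simp: optimal_def intro: rho_gt_1 pos1_M)
    have "rho (M v) ^ length w = rho (M w) ^ length v"
      using that assms by (auto simp: optimal_def intro: antisym)
    then have "rho (M v) ^ length w = (R ^ length v) ^ length w"
      unfolding R(2)[symmetric] by (simp add: power_mult[symmetric] mult.commute)
    then show ?thesis using v R w by (simp add: power_eq_iff_eq_base)
  qed
  then show thesis using that R by blast
qed

text \<open>The growth bound at the eigenvectors of \<open>p @ z\<close> is attained by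
  \<open>p @ z\<close> itself, so \<open>q @ z\<close> cannot exceed it there. Moving the column
  through \<open>M z\<close> splits off the same positive factor on both sides.\<close>

lemma optimal_exchange:
  assumes opt: "optimal A B (p @ z)" and p: "p \<noteq> []" and len: "length q = length p"
  shows "form (M q) (rowfix (p @ z)) (colfix (z @ p)) \<le> form (M p) (rowfix (p @ z)) (colfix (z @ p))"
proof -
  obtain R where R: "R > 0" "R ^ length (p @ z) = rho (M (p @ z))"
    using optimal_growth_rate[OF opt] opt by metis
  have "form (M (q @ z)) (rowfix (p @ z)) (colfix (p @ z)) \<le> rho (M (p @ z)) * (colfix (p @ z) + rowfix (p @ z))"
    using form_optimal_le[OF opt R, of "q @ z"] R(2) len by simp
  also have "\<dots> = form (M (p @ z)) (rowfix (p @ z)) (colfix (p @ z))"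
    using form_fixpt[OF pos1_M, of "p @ z" "rowfix (p @ z)"] p by (simp add: colfix_def)
  finally have le: "form (M q * M z) (rowfix (p @ z)) (colfix (p @ z))
      \<le> form (M p * M z) (rowfix (p @ z)) (colfix (p @ z))" by simp
  show ?thesis
  proof (cases "z = []")
    case True
    then show ?thesis using le by simp
  next
    case False
    have c: "colfix (p @ z) > 0" using p by (simp add: col_row_pos)
    have "e21 (M z) * colfix (p @ z) + e22 (M z) > 0"
      using c False by (intro denom_pos pos1_M)
    then show ?thesis
      using le by (simp add: form_mult[OF pos1_M[OF False] c] col_rotate[OF False p])
  qed
qed

text \<open>If \<open>v\<close> and \<open>w\<close> violated this, the axes of their matrices would be nested and
  \<open>v\<^sup>n w\<^sup>n\<close> would grow faster than both.\<close>

lemma optimal_antichain: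
  assumes v: "optimal A B v" and w: "optimal A B w"
  shows "(colfix v - colfix w) * (rowfix v - rowfix w) \<le> 0"
proof -
  obtain R where R: "R > 0" "\<And>u. optimal A B u \<Longrightarrow> R ^ length u = rho (M u)"
    using optimal_growth_rate[OF v] by metis
  have pw: "pos1 (M w)" using w by (intro pos1_M optimal_nonempty)
  define r where "r = rho (M w)"
  have r: "r > 1" unfolding r_def by (rule rho_gt_1[OF pw])
  have cr: "colfix v + rowfix v > 0" "colfix w + rowfix w > 0"
    using col_row_pos optimal_nonempty v w by (simp_all add: add_pos_pos)
  define \<beta> where "\<beta> = colfix v + rowfix v"
  define \<alpha> where "\<alpha> = (colfix v + rowfix w) * (colfix w + rowfix v) / (colfix w + rowfix w)"
  \<comment> \<open>The rank-one product of the column \<open>(colfix v, 1)\<close> and the row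
    \<open>(1, rowfix v)\<close>. Its trace is \<beta>, and traces against it are values of the form
    at the eigenvectors of \<open>v\<close>, so the trace formula with \<open>N = 1\<close>
    evaluates that form exactly.\<close>
  let ?Q = "M2 (colfix v) (colfix v * rowfix v) 1 (rowfix v)"
  have form_eq: "form (M w) (rowfix v) (colfix v) = tr2 (?Q * M w)"
    by (simp add: form_def tr2_def algebra_simps)
  have "form ?Q (rowfix w) (colfix w) = (colfix v + rowfix w) * (colfix w + rowfix v)"
    by (simp add: form_def algebra_simps)
  then have "tr2 (?Q * M w) = r * \<alpha> + (\<beta> - \<alpha>) / r"
    using tr2_mult_power[OF pw, of ?Q 1]
    by (simp add: \<alpha>_def \<beta>_def r_def colfix_def[of w, symmetric] rowfix_def[of w, symmetric] tr2_def[of ?Q])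
  moreover have "form (M w) (rowfix v) (colfix v) \<le> r * \<beta>"
    using form_optimal_le[OF v R(1) R(2)[OF v], of w] R(2)[OF w] by (simp add: r_def \<beta>_def)
  ultimately have "r * \<alpha> + (\<beta> - \<alpha>) / r \<le> r * \<beta>"
    by (simp add: form_eq)
  then have "(\<alpha> - \<beta>) * (r * r - 1) \<le> 0"
    using r by (simp add: field_simps)
  moreover have "r * r > 1" using r by (simp add: less_1_mult)
  ultimately have "\<alpha> \<le> \<beta>" by (simp add: mult_le_0_iff)
  then have "(colfix v + rowfix w) * (colfix w + rowfix v) \<le> (colfix v + rowfix v) * (colfix w + rowfix w)"
    using cr by (simp add: \<alpha>_def \<beta>_def divide_le_eq)
  then show ?thesis by (simp add: algebra_simps)
qed

end

section \<open>Co-parallel pairs\<close>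

text \<open>The last two assumptions say that \<open>AB - BA\<close> maps the columns \<open>(x, 1)\<close> over the attracting interval
  into the positive ray of the columns \<open>(-y, 1)\<close> with \<open>y > 0\<close>, and the corresponding fact for rows.
  Its trace is zero, so its fourth entry does not occur.\<close>

locale coparallel = positive_pair +
  assumes col_gap: "fixpt A < fixpt B" and row_gap: "fixpt (flip A) < fixpt (flip B)"
    and comm_col: "\<And>x. fixpt A \<le> x \<Longrightarrow> x \<le> fixpt B \<Longrightarrow>
      e11 (A * B) - e11 (B * A) < (e21 (A * B) - e21 (B * A)) * x \<and>
      (e11 (A * B) - e11 (B * A)) * x + (e12 (A * B) - e12 (B * A)) < 0"
    and comm_row: "\<And>x. fixpt (flip A) \<le> x \<Longrightarrow> x \<le> fixpt (flip B) \<Longrightarrow>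
      e11 (A * B) - e11 (B * A) + (e21 (A * B) - e21 (B * A)) * x < 0 \<and>
      (e11 (A * B) - e11 (B * A)) * x < e12 (A * B) - e12 (B * A)"
begin

text \<open>Flipping reverses products. This negates the off-diagonal entries of the commutator and
  keeps its upper left entry, because the trace is zero, so the column and row assumptions change
  places. Column facts thereby yield row facts about reversed words.\<close>

lemma flipped: "coparallel (flip A) (flip B)"
proof
  show "pos1 (flip A)" "pos1 (flip B)" using pos1_A pos1_B by simp_all
  show "fixpt (flip A) < fixpt (flip B)" "fixpt (flip (flip A)) < fixpt (flip (flip B))"
    using col_gap row_gap by simp_all
qed (use comm_col comm_row in \<open>simp_all add: algebra_simps\<close>)

lemma row_eq_col_flipped: "rowfix w = positive_pair.colfix (flip A) (flip B) (rev w)"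
proof -
  interpret f: coparallel "flip A" "flip B" by (rule flipped)
  show ?thesis by (simp add: rowfix_def f.colfix_def word_mat_flip)
qed

text \<open>With the upper versions below: both letters map the interval between the two fixed
  points into itself, and each fixes only its own end.\<close>

lemma mob_letter_lower: "fixpt A \<le> x \<Longrightarrow> fixpt A \<le> mob (if b then A else B) x"
  and mob_letter_lower_strict: "fixpt A \<le> x \<Longrightarrow> fixpt A < x \<or> \<not> b \<Longrightarrow> fixpt A < mob (if b then A else B) x"
proof -
  assume x: "fixpt A \<le> x"
  have p: "fixpt A > 0" by (rule fixpt_pos[OF pos1_A])
  have "mob A x \<ge> fixpt A"
    using mob_le[OF pos1_A p x] by (simp add: mob_fixpt[OF pos1_A])
  moreover have "mob A x > fixpt A" if "fixpt A < x"
    using mob_less[OF pos1_A p that] by (simp add: mob_fixpt[OF pos1_A])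
  moreover have "mob B x > fixpt A"
    using mob_le[OF pos1_B p x] mob_less_iff(2)[OF pos1_B p] col_gap by simp
  ultimately show "fixpt A \<le> mob (if b then A else B) x"
    "fixpt A < x \<or> \<not> b \<Longrightarrow> fixpt A < mob (if b then A else B) x" by auto
qed

lemma mob_letter_upper: "0 < x \<Longrightarrow> x \<le> fixpt B \<Longrightarrow> mob (if b then A else B) x \<le> fixpt B"
  and mob_letter_upper_strict:
    "0 < x \<Longrightarrow> x \<le> fixpt B \<Longrightarrow> x < fixpt B \<or> b \<Longrightarrow> mob (if b then A else B) x < fixpt B"
proof -
  assume x: "0 < x" "x \<le> fixpt B"
  have p: "fixpt B > 0" by (rule fixpt_pos[OF pos1_B])
  have "mob B x \<le> fixpt B"
    using mob_le[OF pos1_B x] by (simp add: mob_fixpt[OF pos1_B])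
  moreover have "mob B x < fixpt B" if "x < fixpt B"
    using mob_less[OF pos1_B x(1) that] by (simp add: mob_fixpt[OF pos1_B])
  moreover have "mob A x < fixpt B"
    using mob_le[OF pos1_A x] mob_less_iff(1)[OF pos1_A p] col_gap by simp
  ultimately show "mob (if b then A else B) x \<le> fixpt B"
    "x < fixpt B \<or> b \<Longrightarrow> mob (if b then A else B) x < fixpt B" by auto
qed

lemma mob_word_lower:
  assumes "w \<noteq> []"
  shows "fixpt A \<le> mob (M w) (fixpt A) \<and> (False \<in> set w \<longrightarrow> fixpt A < mob (M w) (fixpt A))"
  using assms
proof (induction w rule: list_nonempty_induct)
  case (single b)
  then show ?case
    using mob_letter_lower[of "fixpt A" b] mob_letter_lower_strict[of "fixpt A" b] by auto
next
  case (cons b w)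
  have "mob (M (b # w)) (fixpt A) = mob (if b then A else B) (mob (M w) (fixpt A))"
    using mob_mult[OF pos1_M[OF cons(1)] fixpt_pos(1)[OF pos1_A]] by simp
  then show ?case
    using cons.IH mob_letter_lower[of "mob (M w) (fixpt A)" b]
      mob_letter_lower_strict[of "mob (M w) (fixpt A)" b] by auto
qed

lemma mob_word_upper:
  assumes "w \<noteq> []"
  shows "mob (M w) (fixpt B) \<le> fixpt B \<and> (True \<in> set w \<longrightarrow> mob (M w) (fixpt B) < fixpt B)"
  using assms
proof (induction w rule: list_nonempty_induct)
  case (single b)
  then show ?case
    using mob_letter_upper[of "fixpt B" b] mob_letter_upper_strict[of "fixpt B" b] fixpt_pos(1)[OF pos1_B]
    by auto
next
  case (cons b w)
  have "mob (M (b # w)) (fixpt B) = mob (if b then A else B) (mob (M w) (fixpt B))"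
    using mob_mult[OF pos1_M[OF cons(1)] fixpt_pos(1)[OF pos1_B]] by simp
  moreover have "mob (M w) (fixpt B) > 0"
    by (rule mob_pos[OF pos1_M[OF cons(1)] fixpt_pos(1)[OF pos1_B]])
  ultimately show ?case
    using cons.IH mob_letter_upper[of "mob (M w) (fixpt B)" b]
      mob_letter_upper_strict[of "mob (M w) (fixpt B)" b] by auto
qed

text \<open>A word moves neither end of the attracting interval outwards, so its fixed point lies
  between them. A letter that does not fix an end makes the bound at that end strict.\<close>

lemma col_bounds:
  assumes "w \<noteq> []"
  shows "fixpt A \<le> colfix w" "colfix w \<le> fixpt B" "False \<in> set w \<Longrightarrow> fixpt A < colfix w"
    "True \<in> set w \<Longrightarrow> colfix w < fixpt B"
  using mob_word_lower[OF assms] mob_word_upper[OF assms]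
    mob_less_iff[OF pos1_M[OF assms] fixpt_pos(1)[OF pos1_A]]
    mob_less_iff[OF pos1_M[OF assms] fixpt_pos(1)[OF pos1_B]]
  by (auto simp: colfix_def not_less[symmetric])

lemma row_bounds:
  assumes "w \<noteq> []"
  shows "fixpt (flip A) \<le> rowfix w" "rowfix w \<le> fixpt (flip B)" "False \<in> set w \<Longrightarrow> fixpt (flip A) < rowfix w"
    "True \<in> set w \<Longrightarrow> rowfix w < fixpt (flip B)"
  using coparallel.col_bounds[OF flipped, of "rev w"] assms by (simp_all add: row_eq_col_flipped)

lemma row_rotate:
  assumes "p \<noteq> []" "z \<noteq> []"
  shows "mob (flip (M p)) (rowfix (p @ z)) = rowfix (z @ p)"
proof -
  interpret f: coparallel "flip A" "flip B" by (rule flipped)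
  show ?thesis
    using f.col_rotate[of "rev p" "rev z"] assms by (simp add: row_eq_col_flipped word_mat_flip)
qed

text \<open>On the column \<open>(x, 1)\<close> the two products differ by a vector with negative
  first and positive second entry. Adding it to the positive column given by \<open>B * A\<close>
  lowers the ratio of the entries.\<close>

lemma mob_commutator:
  assumes "fixpt A \<le> x" "x \<le> fixpt B"
  shows "mob (A * B) x < mob (B * A) x"
proof -
  have x: "x > 0" using assms(1) fixpt_pos[OF pos1_A] by simp
  have AB: "pos1 (A * B)" "pos1 (B * A)" using pos1_A pos1_B by (auto intro: pos1_mult)
  define a b c d where "a = e11 (A * B) - e11 (B * A)" "b = e12 (A * B) - e12 (B * A)"
    "c = e21 (A * B) - e21 (B * A)" "d = e22 (A * B) - e22 (B * A)"
  note abcd = this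
  have d: "d = - a" by (simp add: abcd algebra_simps)
  define P Q where "P = e11 (B * A) * x + e12 (B * A)" "Q = e21 (B * A) * x + e22 (B * A)"
  note PQ = this
  have pos: "P > 0" "Q > 0" "e21 (A * B) * x + e22 (A * B) > 0"
    using pos1_entries[OF AB(2)] x denom_pos[OF AB(1) x] denom_pos[OF AB(2) x]
    by (simp_all add: PQ add_pos_pos)
  have "a * x + b < 0" "c * x + d > 0"
    using comm_col[OF assms] unfolding d by (simp_all add: abcd)
  then have "(a * x + b) * Q < 0" "P * (c * x + d) > 0"
    using pos by (simp_all add: mult_neg_pos)
  then have "(a * x + b + P) * Q < P * (c * x + d + Q)"
    by (simp add: algebra_simps)
  moreover have "a * x + b + P = e11 (A * B) * x + e12 (A * B)"
    "c * x + d + Q = e21 (A * B) * x + e22 (A * B)"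
    by (simp_all add: abcd PQ algebra_simps)
  ultimately have "(e11 (A * B) * x + e12 (A * B)) * Q < P * (e21 (A * B) * x + e22 (A * B))"
    by simp
  then show ?thesis
    using pos unfolding mob_def PQ(1,2)[symmetric] by (simp add: field_simps)
qed

text \<open>The form of the commutator is affine in each argument. The column assumption makes its
  coefficient of the row variable positive, the row assumption makes that of the column variable
  negative.\<close>

lemma form_commutator_mono:
  assumes \<eta>: "fixpt (flip A) \<le> \<eta>" "\<eta> < \<eta>'" "\<eta>' \<le> fixpt (flip B)"
    and x: "fixpt A \<le> x" "x \<le> y" "y \<le> fixpt B"
  shows "form (A * B) \<eta> y - form (B * A) \<eta> y < form (A * B) \<eta>' x - form (B * A) \<eta>' x"
proof -
  define a b c where "a = e11 (A * B) - e11 (B * A)" "b = e12 (A * B) - e12 (B * A)"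
    "c = e21 (A * B) - e21 (B * A)"
  note abc = this
  have D: "form (A * B) h z - form (B * A) h z = a * z + b + h * (c * z - a)" for h z
    by (simp add: form_def abc algebra_simps)
  have "a < c * y" using comm_col[of y] x by (simp add: abc)
  then have "\<eta> * (c * y - a) < \<eta>' * (c * y - a)" using \<eta> by simp
  moreover have "a + c * \<eta>' < 0" using comm_row[of \<eta>'] \<eta> by (simp add: abc)
  then have "(a + c * \<eta>') * y \<le> (a + c * \<eta>') * x" using x by (simp add: mult_left_mono_neg)
  ultimately show ?thesis unfolding D by (simp add: algebra_simps)
qed

text \<open>Moving the first letter to the end applies the flipped letter to the row, which pulls it
  towards that letter's own end of the row interval: rows fall after \<open>A\<close> and rise after
  \<open>B\<close>.\<close>

lemma row_mixed:
  assumes "True \<in> set v" "False \<in> set v"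
  shows "v \<noteq> []" "tl v \<noteq> []" "0 < rowfix v"
    "fixpt (flip A) < rowfix v" "rowfix v < fixpt (flip B)"
    "rowfix (rotate1 v) = mob (flip (if hd v then A else B)) (rowfix v)"
    "hd v \<Longrightarrow> rowfix (rotate1 v) < rowfix v" "\<not> hd v \<Longrightarrow> rowfix v < rowfix (rotate1 v)"
proof -
  show ne: "v \<noteq> []" and tl: "tl v \<noteq> []" using assms by (cases v; force)+
  show b: "fixpt (flip A) < rowfix v" "rowfix v < fixpt (flip B)" using row_bounds[OF ne] assms by simp_all
  show p: "0 < rowfix v" using ne by (rule col_row_pos)
  show rot: "rowfix (rotate1 v) = mob (flip (if hd v then A else B)) (rowfix v)"
    using row_rotate[of "[hd v]" "tl v"] ne tl by (cases v) (auto split: if_splits)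
  show "hd v \<Longrightarrow> rowfix (rotate1 v) < rowfix v" "\<not> hd v \<Longrightarrow> rowfix v < rowfix (rotate1 v)"
    using rot b mob_less_iff[of "flip A", OF _ p] mob_less_iff[of "flip B", OF _ p] pos1_A pos1_B by simp_all
qed

text \<open>If the claim fails, choose \<open>i\<close> lowest among the words starting with \<open>A\<close> and \<open>j\<close> highest
  among those starting with \<open>B\<close>. Extremality forces \<open>i = AB\<dots>\<close> and \<open>j = BA\<dots>\<close>; exchanging these
  two letters does not increase the growth, which orders the columns of the remaining words and
  contradicts the antichain property at \<open>i, j\<close>.\<close>

lemma threshold:
  assumes fin: "finite P" and opt: "\<And>v. v \<in> P \<Longrightarrow> optimal A B v"
    and mixed: "\<And>v. v \<in> P \<Longrightarrow> True \<in> set v \<and> False \<in> set v"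
    and rot: "\<And>v. v \<in> P \<Longrightarrow> rotate1 v \<in> P"
    and pq: "p \<in> P" "q \<in> P" "hd p" "\<not> hd q"
  shows "rowfix q \<le> rowfix p"
proof (rule ccontr)
  assume neg: "\<not> rowfix q \<le> rowfix p"
  obtain i where i: "i \<in> P" "hd i" "\<And>v. v \<in> P \<Longrightarrow> hd v \<Longrightarrow> rowfix i \<le> rowfix v"
    using arg_min_if_finite[of "{v \<in> P. hd v}" rowfix] fin pq by (force simp: not_less)
  obtain j where j: "j \<in> P" "\<not> hd j" "\<And>v. v \<in> P \<Longrightarrow> \<not> hd v \<Longrightarrow> rowfix v \<le> rowfix j"
    using arg_min_if_finite[of "{v \<in> P. \<not> hd v}" "\<lambda>v. - rowfix v"] fin pq by (force simp: not_less)
  have ij: "rowfix i < rowfix j"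
    using neg i(3)[of p] j(3)[of q] pq by simp
  note mi = row_mixed[of i, OF mixed[OF i(1), THEN conjunct1] mixed[OF i(1), THEN conjunct2]]
  note mj = row_mixed[of j, OF mixed[OF j(1), THEN conjunct1] mixed[OF j(1), THEN conjunct2]]
  \<comment> \<open>Rotation lowers the row of \<open>i\<close>, so another \<open>A\<close> in
    front would contradict minimality; for \<open>j\<close> the situation is mirrored.\<close>
  have "\<not> hd (rotate1 i)" using mi(7) i(3)[OF rot[OF i(1)]] i(2) by (meson not_less)
  then obtain z where z: "i = [True, False] @ z"
    using i(2) mi(1,2) by (cases i; cases "tl i") auto
  have "hd (rotate1 j)" using mj(8) j(3)[OF rot[OF j(1)]] j(2) by (meson not_less)
  then obtain z' where z': "j = [False, True] @ z'"
    using j(2) mj(1,2) by (cases j; cases "tl j") auto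
  have bi: "fixpt A \<le> colfix (z @ [True, False])" "colfix (z @ [True, False]) \<le> fixpt B"
    and bj: "fixpt A \<le> colfix (z' @ [False, True])" "colfix (z' @ [False, True]) \<le> fixpt B"
    using col_bounds by simp_all
  have "form (B * A) (rowfix i) (colfix (z @ [True, False])) \<le> form (A * B) (rowfix i) (colfix (z @ [True, False]))"
    using optimal_exchange[of "[True, False]" z "[False, True]"] opt[OF i(1)] z by simp
  moreover have "form (A * B) (rowfix j) (colfix (z' @ [False, True])) \<le> form (B * A) (rowfix j) (colfix (z' @ [False, True]))"
    using optimal_exchange[of "[False, True]" z' "[True, False]"] opt[OF j(1)] z' by simp
  \<comment> \<open>The exchanges make the commutator form nonnegative for \<open>i\<close> and
    nonpositive for \<open>j\<close>. If the column for \<open>j\<close> were at most that for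
    \<open>i\<close>, monotonicity would make the form strictly larger for \<open>j\<close>.\<close>
  ultimately have "\<not> colfix (z' @ [False, True]) \<le> colfix (z @ [True, False])"
    using form_commutator_mono[OF less_imp_le[OF mi(4)] ij less_imp_le[OF mj(5)] bj(1) _ bi(2)] by force
  then have less: "colfix (z @ [True, False]) < colfix (z' @ [False, True])" by simp
  have AB: "pos1 (A * B)" "pos1 (B * A)" using pos1_A pos1_B by (auto intro: pos1_mult)
  have ci: "colfix i = mob (A * B) (colfix (z @ [True, False]))"
  proof (cases "z = []")
    case True
    then show ?thesis using mob_fixpt[OF AB(1)] by (simp add: z colfix_def)
  next
    case False
    then show ?thesis using col_rotate[of "[True, False]" z] by (simp add: z)
  qed
  have cj: "colfix j = mob (B * A) (colfix (z' @ [False, True]))"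
  proof (cases "z' = []")
    case True
    then show ?thesis using mob_fixpt[OF AB(2)] by (simp add: z' colfix_def)
  next
    case False
    then show ?thesis using col_rotate[of "[False, True]" z'] by (simp add: z')
  qed
  have "colfix i < mob (B * A) (colfix (z @ [True, False]))"
    unfolding ci by (rule mob_commutator[OF bi])
  also have "\<dots> < colfix j"
    unfolding cj using col_row_pos(1)[of "z @ [True, False]"] less by (intro mob_less[OF AB(2)]) auto
  finally have "(colfix i - colfix j) * (rowfix i - rowfix j) > 0"
    using ij by (simp add: mult_neg_neg)
  then show False using optimal_antichain[OF opt[OF i(1)] opt[OF j(1)]] by simp
qed

text \<open>Let \<open>c\<close> be the lowest row starting with \<open>A\<close>. The highest row
  of all must arise by a \<open>B\<close> step from a row below \<open>c\<close>, the lowest by an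
  \<open>A\<close> step from a row above \<open>c\<close>. Hence the image of \<open>p\<close> is at
  most \<open>?rA (?rB c)\<close>, that of \<open>q\<close> at least \<open>?rB (?rA c)\<close>, and
  the commutator inequality of the flipped pair separates these.\<close>

lemma images_separated:
  assumes fin: "finite P" and opt: "\<And>v. v \<in> P \<Longrightarrow> optimal A B v"
    and mixed: "\<And>v. v \<in> P \<Longrightarrow> True \<in> set v \<and> False \<in> set v"
    and rot: "rotate1 ` P = P"
    and pq: "p \<in> P" "q \<in> P" "hd p" "\<not> hd q"
  shows "rowfix (rotate1 p) < rowfix (rotate1 q)"
proof -
  have rotP: "rotate1 v \<in> P" if "v \<in> P" for v using rot that by blast
  note m = row_mixed[OF mixed[THEN conjunct1] mixed[THEN conjunct2]]
  have thr: "rowfix v \<le> rowfix u" if "u \<in> P" "v \<in> P" "hd u" "\<not> hd v" for u v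
    by (rule threshold[OF fin opt mixed rotP]) (use that in auto)
  let ?rA = "mob (flip A)" and ?rB = "mob (flip B)"
  have fl: "pos1 (flip A)" "pos1 (flip B)" using pos1_A pos1_B by simp_all
  obtain i where i: "i \<in> P" "hd i" "\<And>v. v \<in> P \<Longrightarrow> hd v \<Longrightarrow> rowfix i \<le> rowfix v"
    using arg_min_if_finite[of "{v \<in> P. hd v}" rowfix] fin pq by (force simp: not_less)
  define c where "c = rowfix i"
  have c: "0 < c" "fixpt (flip A) \<le> c" "c \<le> fixpt (flip B)"
    using m(3,4,5)[OF i(1) i(1)] by (simp_all add: c_def)
  obtain k where k: "k \<in> P" "\<And>v. v \<in> P \<Longrightarrow> rowfix v \<le> rowfix k"
    using arg_min_if_finite[of P "\<lambda>v. - rowfix v"] fin pq by (force simp: not_less)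
  obtain l where l: "l \<in> P" "\<And>v. v \<in> P \<Longrightarrow> rowfix l \<le> rowfix v"
    using arg_min_if_finite[of P rowfix] fin pq by (force simp: not_less)
  have "rowfix p \<le> ?rB c"
  proof -
    obtain k' where k': "k' \<in> P" "k = rotate1 k'" using rot k(1) by blast
    have nhd: "\<not> hd k'" using m(7)[OF k'(1) k'(1)] k(2)[OF k'(1)] k'(2) by auto
    have "rowfix p \<le> ?rB (rowfix k')" using k(2)[OF pq(1)] m(6)[OF k'(1) k'(1)] nhd k'(2) by simp
    also have "\<dots> \<le> ?rB c"
      using thr[OF i(1) k'(1) i(2) nhd] m(3)[OF k'(1) k'(1)]
      unfolding c_def by (intro mob_le[OF fl(2)]) auto
    finally show ?thesis .
  qed
  moreover have "?rA c \<le> rowfix q"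
  proof -
    obtain l' where l': "l' \<in> P" "l = rotate1 l'" using rot l(1) by blast
    have hd: "hd l'" using m(8)[OF l'(1) l'(1)] l(2)[OF l'(1)] l'(2) by auto
    have "?rA c \<le> ?rA (rowfix l')" using i(3)[OF l'(1) hd] c(1) by (auto simp: c_def intro: mob_le[OF fl(1)])
    also have "\<dots> \<le> rowfix q" using l(2)[OF pq(2)] m(6)[OF l'(1) l'(1)] hd l'(2) by simp
    finally show ?thesis .
  qed
  ultimately have "?rA (rowfix p) \<le> ?rA (?rB c)" "?rB (?rA c) \<le> ?rB (rowfix q)"
    using m(3)[OF pq(1) pq(1)] mob_pos[OF fl(1) c(1)]
    by (auto intro: mob_le[OF fl(1)] mob_le[OF fl(2)])
  moreover have "?rA (?rB c) < ?rB (?rA c)"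
    using coparallel.mob_commutator[OF flipped c(2,3)] mob_mult[OF fl(1) c(1)] mob_mult[OF fl(2) c(1)]
    by simp
  ultimately show ?thesis
    using m(6)[OF pq(1) pq(1)] m(6)[OF pq(2) pq(2)] pq(3,4) by simp
qed

lemma optimal_mixed_rank:
  assumes fin: "finite P" and opt: "\<And>v. v \<in> P \<Longrightarrow> optimal A B v"
    and mixed: "\<And>v. v \<in> P \<Longrightarrow> True \<in> set v \<and> False \<in> set v"
    and rot: "rotate1 ` P = P" and v: "v \<in> P"
  defines "F \<equiv> \<lambda>v. card {u \<in> P. rowfix u < rowfix v}" and "a \<equiv> card {u \<in> P. hd u}"
  shows "F (rotate1 v) + (if hd v then card P else 0) = F v + a" "hd v \<longleftrightarrow> card P - a \<le> F v"
    "F v < card P"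
proof -
  have rotP: "rotate1 v \<in> P" if "v \<in> P" for v using rot that by blast
  note m = row_mixed[OF mixed[THEN conjunct1] mixed[THEN conjunct2]]
  have bij: "bij_betw rotate1 P P"
    using rot fin by (simp add: bij_betw_def eq_card_imp_inj_on)
  have mono: "rowfix (rotate1 p) < rowfix (rotate1 q) \<longleftrightarrow> rowfix p < rowfix q"
    if "p \<in> P" "q \<in> P" "hd p = hd q" for p q
    using that m(3)[OF that(1,1)] m(3)[OF that(2,2)] m(6)[OF that(1,1)] m(6)[OF that(2,2)]
      mob_less_cancel[of "flip A"] mob_less_cancel[of "flip B"] pos1_A pos1_B by simp
  have above: "rowfix v \<le> rowfix u" and swap: "rowfix (rotate1 u) < rowfix (rotate1 v)"
    if "u \<in> P" "v \<in> P" "hd u" "\<not> hd v" for u v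
    by (rule threshold[OF fin opt mixed rotP], use that in auto)
      (rule images_separated[OF fin opt mixed rot], use that in auto)
  note rank = rank_shift[where Y = rowfix and L = hd, OF fin bij above mono swap v]
  show "F (rotate1 v) + (if hd v then card P else 0) = F v + a"
    unfolding F_def a_def by (rule rank(1))
  show "hd v \<longleftrightarrow> card P - a \<le> F v"
    unfolding F_def a_def by (rule rank(2))
  show "F v < card P"
    unfolding F_def using fin v by (intro psubset_card_mono) auto
qed

section \<open>Rotation classes, Christoffel form and uniqueness of the slope\<close>

definition rotations :: "bool list \<Rightarrow> bool list set" where
  "rotations w = range (\<lambda>t. rotate t w)"

lemma rotations_self: "w \<in> rotations w"
  unfolding rotations_def by (rule range_eqI[of _ _ 0]) simp

lemma finite_rotations: "finite (rotations w)"
  by (rule finite_subset[of _ "{v. set v \<subseteq> set w \<and> length v = length w}"])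
    (auto simp: rotations_def finite_lists_length_eq)

lemma rotate1_rotations: "rotate1 ` rotations w = rotations w"
proof (rule card_subset_eq)
  show "rotate1 ` rotations w \<subseteq> rotations w"
    unfolding rotations_def by (auto simp: rotate1_rotate_swap[symmetric]) (metis rangeI rotate_Suc)
  show "card (rotate1 ` rotations w) = card (rotations w)"
    by (intro card_image inj_on_subset[OF inj_rotate1]) auto
qed (rule finite_rotations)

lemma optimal_rotations:
  assumes "optimal A B w" "v \<in> rotations w"
  shows "optimal A B v" "set v = set w" "length v = length w" "count_list v True = count_list w True"
proof -
  obtain t where v: "v = rotate t w" using assms(2) by (auto simp: rotations_def)
  have "optimal A B (rotate t w) \<and> count_list (rotate t w) True = count_list w True"
  proof (induction t)
    case (Suc t)
    have "count_list (rotate1 u) True = count_list u True" for u :: "bool list"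
      by (cases u) auto
    then show ?case using Suc optimal_rotate1 by simp
  qed (use assms in simp)
  then show "optimal A B v" "set v = set w" "length v = length w" "count_list v True = count_list w True"
    by (simp_all add: v)
qed

text \<open>The rotation with the lowest row has rank 0, which is where the coding by
  \<open>christoffel\<close> starts.\<close>

lemma optimal_mixed_christoffel:
  assumes opt: "optimal A B w" and mixed: "True \<in> set w" "False \<in> set w"
  shows "\<exists>v. optimal A B v \<and> v = christoffel (length v) (count_list v True)"
proof -
  note r = optimal_rotations[OF opt]
  define F where "F = (\<lambda>v. card {u \<in> rotations w. rowfix u < rowfix v})"
  note rank = optimal_mixed_rank[OF finite_rotations r(1) _ rotate1_rotations, of w]
  obtain v where v: "v \<in> rotations w" "\<And>u. u \<in> rotations w \<Longrightarrow> rowfix v \<le> rowfix u"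
    using arg_min_if_finite[OF finite_rotations, of w rowfix] rotations_self[of w] by (force simp: not_less)
  have "{u \<in> rotations w. rowfix u < rowfix v} = {}" using v(2) by (auto simp: not_less)
  then have F0: "F v = 0" by (simp only: F_def card.empty)
  have "v = christoffel (length v) (count_list v True)"
  proof (rule eq_christoffel[of "rotations w" F "card (rotations w)" "card {u \<in> rotations w. hd u}"])
    show "rotate1 u \<in> rotations w" if "u \<in> rotations w" for u
      using that rotate1_rotations by blast
  qed (use rank r(2) mixed v(1) F0 in \<open>auto simp: F_def\<close>)
  then show ?thesis using r(1)[OF v(1)] by blast
qed

text \<open>Ranking both rotation classes inside one union makes the two words code the same circle
  rotation, of rotation number \<open>a / card P\<close>.\<close>

lemma optimal_mixed_slope:
  assumes opt: "optimal A B v" "optimal A B w"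
    and mixed: "True \<in> set v" "False \<in> set v" "True \<in> set w" "False \<in> set w"
  shows "length v * count_list w True = length w * count_list v True"
proof -
  define P where "P = rotations v \<union> rotations w"
  have fin: "finite P" by (simp add: P_def finite_rotations)
  have rot: "rotate1 ` P = P" by (simp add: P_def image_Un rotate1_rotations)
  have P: "optimal A B u" "True \<in> set u \<and> False \<in> set u" if "u \<in> P" for u
    using that mixed optimal_rotations[OF opt(1)] optimal_rotations[OF opt(2)] by (auto simp: P_def)
  note rank = optimal_mixed_rank(1)[OF fin P rot]
  have vw: "v \<in> P" "w \<in> P" by (simp_all add: P_def rotations_self)
  define a where "a = card {u \<in> P. hd u}"
  have "card P * count_list u True = length u * a" if "u \<in> P" for u
    unfolding a_def
    by (rule rotation_number[OF rank _ that]) (use rot in auto)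
  from this[OF vw(1)] this[OF vw(2)]
  have "card P * (length v * count_list w True) = card P * (length w * count_list v True)"
    by (simp only: mult.left_commute[of "card P"]) (simp only: mult.left_commute[of "length w"])
  moreover have "card P > 0" using fin vw by (auto simp: card_gt_0_iff)
  ultimately show ?thesis by simp
qed

lemma bool_subset_singleton: "S \<subseteq> {b} \<longleftrightarrow> (\<not> b) \<notin> S"
proof
  assume b: "(\<not> b) \<notin> S"
  show "S \<subseteq> {b}"
  proof
    fix x assume "x \<in> S"
    then have "x \<noteq> (\<not> b)" using b by blast
    then show "x \<in> {b}" by simp
  qed
qed auto

text \<open>A single letter sits at a corner of the box that confines all pairs of column and row. A
  word with the other letter differs from it strictly and in the same direction in both coordinates,
  which the antichain property forbids.\<close>

lemma optimal_letter_unique: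
  assumes "optimal A B [b]" "optimal A B w"
  shows "set w \<subseteq> {b}"
proof (rule ccontr)
  assume "\<not> set w \<subseteq> {b}"
  then have other: "(\<not> b) \<in> set w" by (simp add: bool_subset_singleton)
  have ne: "w \<noteq> []" using assms(2) by (rule optimal_nonempty)
  have letter: "colfix [b] = fixpt (if b then A else B)" "rowfix [b] = fixpt (flip (if b then A else B))"
    by (simp_all add: colfix_def rowfix_def)
  have "(colfix [b] - colfix w) * (rowfix [b] - rowfix w) > 0"
  proof (cases b)
    case True
    then show ?thesis
      unfolding letter using other col_bounds(3)[OF ne] row_bounds(3)[OF ne]
      by (simp add: mult_neg_neg)
  next
    case False
    then show ?thesis
      unfolding letter using other col_bounds(4)[OF ne] row_bounds(4)[OF ne] by simp
  qed
  then show False using optimal_antichain[OF assms] by simp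
qed

lemma replicate_length_pure: "set w \<subseteq> {b} \<Longrightarrow> replicate (length w) b = w"
  by (intro replicate_length_same) auto

lemma count_list_pure: "set w \<subseteq> {b} \<Longrightarrow> count_list w True = (if b then length w else 0)"
  by (induction w) (cases b; simp)+

lemma optimal_pure:
  assumes "optimal A B w" "set w \<subseteq> {b}"
  shows "optimal A B [b]"
proof -
  have "concat (replicate (length w) [b]) = w"
    using replicate_length_pure[OF assms(2)] by (simp add: concat_replicate_single)
  then show ?thesis
    using optimal_concat_replicate[of "length w" "[b]"] assms(1) optimal_nonempty by fastforce
qed

theorem optimal_slope:
  assumes "optimal A B v" "optimal A B w"
  shows "length v * count_list w True = length w * count_list v True"
proof (cases "\<exists>b. optimal A B [b]")
  case True
  then obtain b where b: "optimal A B [b]" by blast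
  show ?thesis
    by (simp add: count_list_pure[OF optimal_letter_unique[OF b assms(1)]]
        count_list_pure[OF optimal_letter_unique[OF b assms(2)]])
next
  case False
  have "b \<in> set u" if "optimal A B u" for u b
  proof (rule ccontr)
    assume "b \<notin> set u"
    then have "set u \<subseteq> {\<not> b}" by (simp add: bool_subset_singleton)
    then show False using optimal_pure that False by blast
  qed
  then show ?thesis using assms by (intro optimal_mixed_slope) auto
qed

theorem optimal_christoffel:
  assumes "optimal A B w"
  shows "\<exists>v. optimal A B v \<and> v = christoffel (length v) (count_list v True)"
proof (cases "True \<in> set w \<and> False \<in> set w")
  case False
  then obtain b where w: "set w \<subseteq> {b}" by (metis bool_subset_singleton)
  have "christoffel m (if b then m else 0) = replicate m b" for m
    by (cases b; auto simp: christoffel_def intro!: nth_equalityI)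
  then have "christoffel (length w) (count_list w True) = w"
    by (simp add: count_list_pure[OF w] replicate_length_pure[OF w])
  then show ?thesis using assms by metis
qed (use assms optimal_mixed_christoffel in auto)

end

section \<open>Spectrum maximizing products\<close>

definition to_mat :: "m2 \<Rightarrow> real mat" where
  "to_mat X = mat_of_rows_list 2 [[e11 X, e12 X], [e21 X, e22 X]]"

lemma mat_of_rows_list_2_mult:
  fixes a b c d :: "'a :: comm_ring_1"
  shows "mat_of_rows_list 2 [[a, b], [c, d]] * mat_of_rows_list 2 [[a', b'], [c', d']] =
    mat_of_rows_list 2 [[a * a' + b * c', a * b' + b * d'], [c * a' + d * c', c * b' + d * d']]"
    (is "?X * ?Y = ?Z")
proof (rule eq_matI)
  fix i j assume "i < dim_row ?Z" "j < dim_col ?Z"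
  then have "i < 2" "j < 2" by (simp_all add: mat_of_rows_list_def)
  then show "(?X * ?Y) $$ (i, j) = ?Z $$ (i, j)"
    by (auto simp: mat_of_rows_list_def scalar_prod_def numeral_2_eq_2 less_Suc_eq)
qed (simp_all add: mat_of_rows_list_def)

lemma to_mat_carrier: "to_mat X \<in> carrier_mat 2 2"
  by (simp add: to_mat_def mat_of_rows_list_2_carrier)

lemma to_mat_mult: "to_mat (X * Y) = to_mat X * to_mat Y"
  by (simp add: to_mat_def mat_of_rows_list_2_mult)

lemma to_mat_one: "to_mat 1 = 1\<^sub>m 2"
  by (rule eq_matI) (auto simp: to_mat_def mat_of_rows_list_def numeral_2_eq_2 less_Suc_eq)

lemma mat2_prod_to_mat:
  "mat2_prod (map (\<lambda>b. if b then to_mat A else to_mat B) w) = to_mat (word_mat A B w)"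
  by (induction w) (auto simp: mat2_prod_def to_mat_mult to_mat_one)

lemma characteristic_equation_2:
  fixes a b c d k x y :: "'a :: field"
  assumes "a * x + b * y = k * x" "c * x + d * y = k * y" "a * d = 1 + b * c"
  shows "(k * k - (a + d) * k + 1) * x = 0" "(k * k - (a + d) * k + 1) * y = 0"
proof -
  have "(k * k - (a + d) * k + 1) * x = (k - d) * (k * x - (a * x + b * y)) + b * (k * y - (c * x + d * y))
      + (1 + b * c - a * d) * x"
    by (simp add: algebra_simps)
  then show "(k * k - (a + d) * k + 1) * x = 0" unfolding assms by simp
  have "(k * k - (a + d) * k + 1) * y = (k - a) * (k * y - (c * x + d * y)) + c * (k * x - (a * x + b * y))
      + (1 + b * c - a * d) * y"
    by (simp add: algebra_simps)
  then show "(k * k - (a + d) * k + 1) * y = 0" unfolding assms by simp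
qed

text \<open>The dominant column shows that \<open>rho X\<close> is an eigenvalue. Every complex
  eigenvalue satisfies the characteristic equation, whose roots are \<open>rho X\<close> and its
  inverse.\<close>

lemma spectral_radius_to_mat:
  assumes X: "pos1 X"
  shows "real_spectral_radius (to_mat X) = rho X"
proof -
  let ?C = "map_mat complex_of_real (to_mat X)"
  have C: "?C \<in> carrier_mat 2 2" using to_mat_carrier by simp
  have entries: "?C $$ (0, 0) = e11 X" "?C $$ (0, 1) = e12 X" "?C $$ (1, 0) = e21 X" "?C $$ (1, 1) = e22 X"
    "dim_row ?C = 2" "dim_col ?C = 2"
    by (simp_all add: to_mat_def mat_of_rows_list_def)
  have mult: "(?C *\<^sub>v v) $ 0 = e11 X * v $ 0 + e12 X * v $ 1"
    "(?C *\<^sub>v v) $ 1 = e21 X * v $ 0 + e22 X * v $ 1" if "v \<in> carrier_vec 2" for v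
    using that entries by (auto simp: scalar_prod_def numeral_2_eq_2 row_def)
  note pos = pos1_entries[OF X]
  have r: "rho X > 1" by (rule rho_gt_1[OF X])
  have "eigenvalue ?C (rho X)"
  proof -
    define v where "v = vec 2 (\<lambda>i. if i = 0 then complex_of_real (fixpt X) else 1)"
    have v: "v \<in> carrier_vec 2" "v $ 0 = fixpt X" "v $ 1 = 1"
      by (simp_all add: v_def)
    have fx: "fixpt X * e21 X = rho X - e22 X" using pos by (simp add: fixpt_def)
    have "e11 X * fixpt X + e12 X = rho X * fixpt X"
    proof -
      have "e21 X * (e11 X * fixpt X + e12 X) = e11 X * (fixpt X * e21 X) + e12 X * e21 X"
        by (simp add: distrib_left mult_ac)
      also have "\<dots> = rho X * (fixpt X * e21 X)"
        unfolding fx rho_root'[OF X, symmetric] by (simp add: distrib_right[symmetric])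
      finally have "e21 X * (e11 X * fixpt X + e12 X) = e21 X * (rho X * fixpt X)"
        by (simp only: mult_ac)
      then show ?thesis using pos(3) by simp
    qed
    then have c0: "complex_of_real (e11 X) * fixpt X + e12 X = complex_of_real (rho X) * fixpt X"
      by (simp only: of_real_add[symmetric] of_real_mult[symmetric])
    have "e21 X * fixpt X + e22 X = rho X" using fx by (simp add: mult.commute)
    then have c1: "complex_of_real (e21 X) * fixpt X + e22 X = rho X"
      by (simp only: of_real_add[symmetric] of_real_mult[symmetric])
    have "?C *\<^sub>v v = complex_of_real (rho X) \<cdot>\<^sub>v v"
    proof (rule eq_vecI)
      fix i assume "i < dim_vec (complex_of_real (rho X) \<cdot>\<^sub>v v)"
      then have "i = 0 \<or> i = 1" using v(1) by auto
      then show "(?C *\<^sub>v v) $ i = (complex_of_real (rho X) \<cdot>\<^sub>v v) $ i"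
        using mult[OF v(1)] v c0 c1 by auto
    qed (use v(1) entries in auto)
    moreover have "v \<noteq> 0\<^sub>v 2" using v(3) by auto
    ultimately show ?thesis using v(1) entries by (auto simp: eigenvalue_def eigenvector_def)
  qed
  then have mem: "rho X \<in> norm ` spectrum ?C"
    using r by (auto simp: spectrum_def image_iff intro!: exI[of _ "complex_of_real (rho X)"])
  have "norm k \<le> rho X" if k: "k \<in> spectrum ?C" for k
  proof -
    obtain v where "eigenvector ?C v k"
      using k by (auto simp: spectrum_def eigenvalue_def)
    then have v: "v \<in> carrier_vec 2" "v \<noteq> 0\<^sub>v 2" "?C *\<^sub>v v = k \<cdot>\<^sub>v v"
      unfolding eigenvector_def entries(5) by simp_all
    have eqs: "e11 X * v $ 0 + e12 X * v $ 1 = k * v $ 0" "e21 X * v $ 0 + e22 X * v $ 1 = k * v $ 1"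
      using mult[OF v(1)] v(1,3) by auto
    have "v $ 0 \<noteq> 0 \<or> v $ 1 \<noteq> 0"
      using v(1,2) by (auto intro!: eq_vecI simp: less_2_cases_iff)
    moreover have det: "complex_of_real (e11 X) * e22 X = 1 + complex_of_real (e12 X) * e21 X"
      using arg_cong[OF pos(5), of complex_of_real] by simp
    note characteristic_equation_2[OF eqs det]
    ultimately have "k * k - (complex_of_real (e11 X) + e22 X) * k + 1 = 0" by (metis mult_eq_0_iff)
    moreover have "complex_of_real (e11 X) + e22 X = rho X + 1 / rho X"
      using arg_cong[OF tr2_eq_rho[OF X], of complex_of_real] by (simp add: tr2_def)
    ultimately have "k * k - (rho X + 1 / rho X) * k + 1 = 0" by simp
    moreover have "(k - rho X) * (k - 1 / rho X) = k * k - (rho X + 1 / rho X) * k + 1"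
      using r by (simp add: field_simps)
    ultimately have "k = rho X \<or> k = 1 / rho X" by auto
    then show ?thesis
    proof
      assume "k = 1 / rho X"
      then have "norm k = 1 / rho X" using r by (simp add: norm_divide)
      also have "\<dots> \<le> 1" using r by simp
      finally show ?thesis using r by simp
    qed (use r in simp)
  qed
  then show ?thesis
    unfolding real_spectral_radius_def spectral_radius_def
    using card_finite_spectrum(1)[OF C] mem by (intro Max_eqI) auto
qed

lemma words_to_mat:
  "words (to_mat A) (to_mat B) n = map (\<lambda>b. if b then to_mat A else to_mat B) ` {w. length w = n}"
proof -
  have "Xs \<in> map (\<lambda>b. if b then to_mat A else to_mat B) ` {w. length w = n}"
    if "length Xs = n" "set Xs \<subseteq> {to_mat A, to_mat B}" for Xs
  proof (rule image_eqI)
    \<comment> \<open>This decoding stays valid if the two matrices coincide: every entry is then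
      read as \<open>True\<close>.\<close>
    show "Xs = map (\<lambda>b. if b then to_mat A else to_mat B) (map (\<lambda>X. X = to_mat A) Xs)"
      using that(2) by (induction Xs) auto
  qed (use that in simp)
  then show ?thesis by (auto simp: words_def)
qed

lemma root_le_root_iff:
  assumes "m > 0" "n > 0" "0 \<le> a" "0 \<le> (b::real)"
  shows "root m a \<le> root n b \<longleftrightarrow> a ^ n \<le> b ^ m"
proof -
  have "root m a \<le> root n b \<longleftrightarrow> root m a ^ (m * n) \<le> root n b ^ (m * n)"
    using assms by (simp add: power_mono_iff)
  also have "root m a ^ (m * n) = a ^ n" using assms by (simp add: power_mult)
  also have "root n b ^ (m * n) = b ^ m" using assms by (simp add: mult.commute[of m] power_mult)
  finally show ?thesis .
qed

context positive_pair
begin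

definition max_rho :: "nat \<Rightarrow> real" where
  "max_rho n = Max ((\<lambda>w. rho (M w)) ` {w. length w = n})"

lemma finite_bool_lists: "finite {w :: bool list. length w = n}"
  using finite_lists_length_eq[of "UNIV :: bool set" n] by simp

lemma max_rho_attained: "\<exists>w. length w = n \<and> max_rho n = rho (M w)"
proof -
  have "max_rho n \<in> (\<lambda>w. rho (M w)) ` {w. length w = n}"
    unfolding max_rho_def using finite_bool_lists[of n]
    by (intro Max_in) (auto intro: exI[of _ "replicate n True"])
  then show ?thesis by auto
qed

lemma rho_le_max_rho: "rho (M w) \<le> max_rho (length w)"
  unfolding max_rho_def using finite_bool_lists by (intro Max_ge) auto

lemma joint_spectral_radius_eq:
  "joint_spectral_radius (to_mat A) (to_mat B) = limsup (\<lambda>n. ereal (root n (max_rho n)))"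
proof -
  have "root n (Max ((\<lambda>Xs. real_spectral_radius (mat2_prod Xs)) ` words (to_mat A) (to_mat B) n))
      = root n (max_rho n)" for n
  proof (cases "n = 0")
    case False
    have "(\<lambda>Xs. real_spectral_radius (mat2_prod Xs)) ` words (to_mat A) (to_mat B) n
        = (\<lambda>w. rho (M w)) ` {w. length w = n}"
      unfolding words_to_mat image_image mat2_prod_to_mat
      using False by (intro image_cong) (auto simp: spectral_radius_to_mat pos1_M)
    then show ?thesis by (simp add: max_rho_def)
  qed simp
  then show ?thesis by (simp add: joint_spectral_radius_def)
qed

text \<open>Powers of \<open>v\<close> are arbitrarily long and have the same normalised radius, so
  every tail of the sequence contains a term at least this large.\<close>

lemma root_rho_le_limsup:
  assumes "v \<noteq> []"
  shows "ereal (root (length v) (rho (M v))) \<le> limsup (\<lambda>n. ereal (root n (max_rho n)))"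
  unfolding limsup_INF_SUP
proof (rule INF_greatest)
  fix n
  define u where "u = concat (replicate (Suc n) v)"
  have len: "length u = Suc n * length v"
    unfolding u_def by (induction n) simp_all
  have r: "rho (M v) > 1" using assms by (intro rho_gt_1 pos1_M)
  have "rho (M v) ^ Suc n = rho (M u)"
    using assms unfolding u_def word_mat_concat_replicate by (intro rho_power[symmetric] pos1_M) auto
  also have "\<dots> \<le> max_rho (length u)" by (rule rho_le_max_rho)
  finally have le: "rho (M v) ^ Suc n \<le> max_rho (length u)" .
  have nonneg: "0 \<le> max_rho (length u)"
    using r by (intro order.trans[OF _ le] zero_le_power) simp
  have "rho (M v) ^ length u = (rho (M v) ^ Suc n) ^ length v"
    by (simp only: len power_mult)
  also have "\<dots> \<le> max_rho (length u) ^ length v"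
    using le r by (intro power_mono) auto
  finally have "root (length v) (rho (M v)) \<le> root (length u) (max_rho (length u))"
    using assms r nonneg len by (subst root_le_root_iff) simp_all
  moreover have "length u \<in> {n..}"
    using assms len by (cases "length v") auto
  ultimately show "ereal (root (length v) (rho (M v))) \<le> (SUP m\<in>{n..}. ereal (root m (max_rho m)))"
    by (intro SUP_upper2[of "length u"]) auto
qed

lemma limsup_le_optimal:
  assumes "optimal A B w"
  shows "limsup (\<lambda>n. ereal (root n (max_rho n))) \<le> ereal (root (length w) (rho (M w)))"
proof (rule Limsup_bounded, rule eventually_sequentiallyI)
  fix n :: nat assume n: "1 \<le> n"
  obtain v where v: "length v = n" "max_rho n = rho (M v)" using max_rho_attained by blast
  have "v \<noteq> []" "w \<noteq> []" using n v assms by (auto simp: optimal_def)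
  then have "rho (M v) > 1" "rho (M w) > 1" by (auto intro: rho_gt_1 pos1_M)
  then show "ereal (root n (max_rho n)) \<le> ereal (root (length w) (rho (M w)))"
    using assms n v \<open>v \<noteq> []\<close> \<open>w \<noteq> []\<close> by (auto simp: root_le_root_iff optimal_def)
qed

lemma spectrum_maximizing_product_iff:
  "(\<exists>Xs. spectrum_maximizing_product (to_mat A) (to_mat B) Xs) \<longleftrightarrow> (\<exists>w. optimal A B w)"
proof
  let ?f = "\<lambda>b. if b then to_mat A else to_mat B"
  assume "\<exists>Xs. spectrum_maximizing_product (to_mat A) (to_mat B) Xs"
  then obtain Xs where Xs: "length Xs \<ge> 1" "Xs \<in> words (to_mat A) (to_mat B) (length Xs)"
    "ereal (root (length Xs) (real_spectral_radius (mat2_prod Xs)))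
      = joint_spectral_radius (to_mat A) (to_mat B)"
    unfolding spectrum_maximizing_product_def by blast
  then obtain w where w: "Xs = map ?f w" unfolding words_to_mat by blast
  then have ne: "w \<noteq> []" using Xs(1) by auto
  have eq: "ereal (root (length w) (rho (M w))) = limsup (\<lambda>n. ereal (root n (max_rho n)))"
    using Xs(3) ne unfolding w mat2_prod_to_mat joint_spectral_radius_eq
    by (simp add: spectral_radius_to_mat pos1_M)
  have "rho (M v) ^ length w \<le> rho (M w) ^ length v" if v: "v \<noteq> []" for v
  proof -
    have "rho (M v) > 1" "rho (M w) > 1" using ne v by (auto intro: rho_gt_1 pos1_M)
    then show ?thesis
      using root_rho_le_limsup[OF v] ne v by (simp add: eq[symmetric] root_le_root_iff)
  qed
  then show "\<exists>w. optimal A B w" using ne by (auto simp: optimal_def)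
next
  let ?f = "\<lambda>b. if b then to_mat A else to_mat B"
  assume "\<exists>w. optimal A B w"
  then obtain w where w: "optimal A B w" by blast
  then have ne: "w \<noteq> []" by (rule optimal_nonempty)
  have "ereal (root (length w) (rho (M w))) = limsup (\<lambda>n. ereal (root n (max_rho n)))"
    using limsup_le_optimal[OF w] root_rho_le_limsup[OF ne] by (rule antisym[rotated])
  then have "spectrum_maximizing_product (to_mat A) (to_mat B) (map ?f w)"
    using ne unfolding spectrum_maximizing_product_def mat2_prod_to_mat joint_spectral_radius_eq
    by (auto simp: words_to_mat spectral_radius_to_mat pos1_M Suc_le_eq)
  then show "\<exists>Xs. spectrum_maximizing_product (to_mat A) (to_mat B) Xs" by blast
qed

end

section \<open>The one-parameter family\<close>

text \<open>The matrix with eigenvector \<open>(s, 1)\<close> for \<open>l\<close> and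
  \<open>(u, 1)\<close> for \<open>1 / l\<close>, multiplied out.\<close>

definition hyp :: "real \<Rightarrow> real \<Rightarrow> real \<Rightarrow> m2" where
  "hyp s u l = M2 ((s * l - u / l) / (s - u)) (- (s * u) * (l - 1 / l) / (s - u))
     ((l - 1 / l) / (s - u)) ((s / l - u * l) / (s - u))"

lemma entries_hyp:
  "e11 (hyp s u l) = (s * l - u / l) / (s - u)" "e12 (hyp s u l) = - (s * u) * (l - 1 / l) / (s - u)"
  "e21 (hyp s u l) = (l - 1 / l) / (s - u)" "e22 (hyp s u l) = (s / l - u * l) / (s - u)"
  by (simp_all add: hyp_def)

lemma H_eq_to_mat:
  assumes "u < s"
  shows "H s u l = to_mat (hyp s u l)"
proof -
  have "(s * l * (- u) + u * inverse l * s) / (s - u) = - (s * u) * (l - 1 / l) / (s - u)"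
    by (simp add: algebra_simps inverse_eq_divide)
  then show ?thesis
    unfolding H_def mat_inverse_H_base[OF assms] option.sel
    unfolding H_base_def mat_of_rows_list_2_mult to_mat_def entries_hyp
    by (simp add: inverse_eq_divide diff_divide_distrib add_divide_distrib mult.commute)
qed

text \<open>The dominant row annihilates the other eigenvector \<open>(u, 1)\<close>, so it is
  \<open>(1, - u)\<close>; this puts \<open>- u\<close> in the place of the attracting
  point.\<close>

lemma flip_hyp: "flip (hyp s u l) = hyp (- u) (- s) l"
  by (simp add: flip_def hyp_def)

lemma hyp_facts:
  assumes "u < 0" "0 < s" "1 < l"
  shows pos1_hyp: "pos1 (hyp s u l)" and fixpt_hyp: "fixpt (hyp s u l) = s"
    and rho_hyp: "rho (hyp s u l) = l"
proof -
  have w: "l - 1 / l > 0" using assms(3) by (simp add: field_simps less_1_mult)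
  have d: "s - u > 0" using assms by simp
  have l: "l \<noteq> 0" using assms by simp
  have sl: "s * l > 0" "u / l < 0" "s / l > 0" "u * l < 0"
    using assms by (simp_all add: divide_neg_pos mult_neg_pos)
  have "(s * l - u / l) * (s / l - u * l) + (s * u) * (l - 1 / l) * (l - 1 / l) = (s - u) * (s - u)"
    using l by (simp add: field_simps)
  moreover have "det2 (hyp s u l) =
      ((s * l - u / l) * (s / l - u * l) + (s * u) * (l - 1 / l) * (l - 1 / l)) / ((s - u) * (s - u))"
    by (simp add: det2_def entries_hyp add_divide_distrib)
  ultimately have det: "det2 (hyp s u l) = 1" using d by simp
  have "- (s * u) * (l - 1 / l) / (s - u) > 0"
    using w d assms by (intro divide_pos_pos mult_pos_pos) (auto simp: mult_less_0_iff)
  then show p: "pos1 (hyp s u l)"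
    unfolding pos1_def using det w d sl by (simp add: entries_hyp)
  have "e21 (hyp s u l) * s + e22 (hyp s u l) = ((l - 1 / l) * s + (s / l - u * l)) / (s - u)"
    by (simp add: entries_hyp add_divide_distrib)
  also have "(l - 1 / l) * s + (s / l - u * l) = l * (s - u)" by (simp add: algebra_simps)
  finally have den: "e21 (hyp s u l) * s + e22 (hyp s u l) = l" using d by simp
  have "e11 (hyp s u l) * s + e12 (hyp s u l) = ((s * l - u / l) * s - s * u * (l - 1 / l)) / (s - u)"
    by (simp add: entries_hyp diff_divide_distrib left_diff_distrib)
  also have "(s * l - u / l) * s - s * u * (l - 1 / l) = s * l * (s - u)"
    by (simp add: algebra_simps)
  finally have num: "e11 (hyp s u l) * s + e12 (hyp s u l) = s * l" using d by simp
  have "mob (hyp s u l) s = s" unfolding mob_def den num using l by simp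
  then show f: "fixpt (hyp s u l) = s" using fixpt_unique[OF p] assms by simp
  show "rho (hyp s u l) = l"
    using f den pos1_entries(3)[OF p] by (simp add: fixpt_def field_simps)
qed

text \<open>The commutator entries share the positive factor \<open>k\<close>, which carries all
  dependence on \<open>l\<close> and \<open>l'\<close>; what remains is polynomial in the four
  eigenvector positions. Each required inequality is affine in \<open>x\<close>, so it is written as
  a positive combination of the distances from \<open>x\<close> to the two ends, the coefficients
  being read off at the ends.\<close>

lemma coparallel_hyp:
  assumes u: "u' < u" "u < 0" and s: "0 < s" "s < s'" and l: "1 < l" "1 < l'"
  shows "coparallel (hyp s u l) (hyp s' u' l')"
proof -
  let ?A = "hyp s u l" and ?B = "hyp s' u' l'"
  have neg: "u' < 0" "0 < s'" using u s by simp_all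
  note A = hyp_facts[OF u(2) s(1) l(1)] and B = hyp_facts[OF neg l(2)]
  have fA: "fixpt (flip ?A) = - u" and fB: "fixpt (flip ?B) = - u'"
    unfolding flip_hyp using u s l neg by (simp_all add: fixpt_hyp)
  define w w' d d' where "w = l - 1 / l" "w' = l' - 1 / l'" "d = s - u" "d' = s' - u'"
  note defs = this
  define k where "k = w * w' / (d * d')"
  have pos: "w > 0" "w' > 0" "d > 0" "d' > 0"
    using l u s by (simp_all add: defs field_simps less_1_mult)
  then have k: "k > 0" by (simp add: k_def)
  have diag: "p * q - r / q - (p / q - r * q) = (p + r) * (q - 1 / q)" for p q r :: real
    by (simp add: algebra_simps add_divide_distrib)
  have eA: "e12 ?A = - (s * u) * w / d" "e21 ?A = w / d" "e11 ?A - e22 ?A = (s + u) * w / d"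
    by (simp_all add: entries_hyp defs diff_divide_distrib[symmetric] diag)
  have eB: "e12 ?B = - (s' * u') * w' / d'" "e21 ?B = w' / d'" "e11 ?B - e22 ?B = (s' + u') * w' / d'"
    by (simp_all add: entries_hyp defs diff_divide_distrib[symmetric] diag)
  define a b c where "a = s' * u' - s * u" "b = s * u * (s' + u') - s' * u' * (s + u)"
    "c = s' + u' - s - u"
  note abc = this
  have c11: "e11 (?A * ?B) - e11 (?B * ?A) = k * a"
    unfolding entries_mult eA eB k_def abc using pos by (simp add: field_simps)
  have "e12 (?A * ?B) - e12 (?B * ?A) = (e11 ?A - e22 ?A) * e12 ?B - (e11 ?B - e22 ?B) * e12 ?A"
    by (simp add: algebra_simps)
  also have "\<dots> = k * b"
    unfolding eA eB k_def abc using pos by (simp add: field_simps)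
  finally have c12: "e12 (?A * ?B) - e12 (?B * ?A) = k * b" .
  have "e21 (?A * ?B) - e21 (?B * ?A) = (e11 ?B - e22 ?B) * e21 ?A - (e11 ?A - e22 ?A) * e21 ?B"
    by (simp add: algebra_simps)
  also have "\<dots> = k * c"
    unfolding eA eB k_def abc using pos by (simp add: field_simps)
  finally have c21: "e21 (?A * ?B) - e21 (?B * ?A) = k * c" .
  have gaps: "s - u' > 0" "s' - u > 0" using u s by simp_all
  have combo: "p * ((q - z) * (s - u')) + p' * ((z - q') * (s' - u)) > 0"
    if "p > 0" "p' > 0" "q' \<le> z" "z \<le> q" "q' < q" for p p' q q' z :: real
  proof (cases "z = q")
    case True
    then show ?thesis using that gaps by simp
  next
    case False
    then have "p * ((q - z) * (s - u')) > 0" "p' * ((z - q') * (s' - u)) \<ge> 0"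
      using that gaps by simp_all
    then show ?thesis by simp
  qed
  show ?thesis
  proof
    fix x assume "fixpt ?A \<le> x" "x \<le> fixpt ?B"
    then have x: "s \<le> x" "x \<le> s'" using A B by simp_all
    have "c * x - a = 1 * ((s' - x) * (s - u')) + 1 * ((x - s) * (s' - u))"
      by (simp add: abc algebra_simps)
    then have "a < c * x" using combo[OF _ _ x s(2), of 1 1] by simp
    moreover have "- (a * x + b) = (- u) * ((s' - x) * (s - u')) + (- u') * ((x - s) * (s' - u))"
      by (simp add: abc algebra_simps)
    then have "a * x + b < 0" using combo[OF _ _ x s(2), of "- u" "- u'"] u by simp
    ultimately have "k * a < k * (c * x)" "k * (a * x + b) < 0"
      using k by (simp_all add: mult_pos_neg)
    then show "e11 (?A * ?B) - e11 (?B * ?A) < (e21 (?A * ?B) - e21 (?B * ?A)) * x \<and>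
        (e11 (?A * ?B) - e11 (?B * ?A)) * x + (e12 (?A * ?B) - e12 (?B * ?A)) < 0"
      unfolding c11 c12 c21 by (simp add: algebra_simps)
  next
    fix x assume "fixpt (flip ?A) \<le> x" "x \<le> fixpt (flip ?B)"
    then have x: "u' \<le> - x" "- x \<le> u" unfolding fA fB by simp_all
    have "- (a + c * x) = 1 * ((u - - x) * (s - u')) + 1 * ((- x - u') * (s' - u))"
      by (simp add: abc algebra_simps)
    then have "a + c * x < 0" using combo[OF _ _ x u(1), of 1 1] by simp
    moreover have "b - a * x = s' * ((u - - x) * (s - u')) + s * ((- x - u') * (s' - u))"
      by (simp add: abc algebra_simps)
    then have "a * x < b" using combo[OF _ _ x u(1), of s' s] s by simp
    ultimately have "k * (a + c * x) < 0" "k * (a * x) < k * b"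
      using k by (simp_all add: mult_pos_neg)
    then show "e11 (?A * ?B) - e11 (?B * ?A) + (e21 (?A * ?B) - e21 (?B * ?A)) * x < 0 \<and>
        (e11 (?A * ?B) - e11 (?B * ?A)) * x < e12 (?A * ?B) - e12 (?B * ?A)"
      unfolding c11 c12 c21 by (simp add: algebra_simps)
  qed (use A B fA fB s u in simp_all)
qed

text \<open>If \<open>B\<close> stretches neither entry of the eigenvector \<open>(s, 1)\<close> of
  \<open>A\<close> by more than \<open>rho A\<close>, positivity propagates this bound through every
  word. Pairing with the dominant row of the word turns it into a bound on its spectral
  radius.\<close>

lemma (in positive_pair) optimal_A_if_dominant:
  assumes s: "fixpt A = s" and B: "e11 B * s + e12 B \<le> rho A * s" "e21 B * s + e22 B \<le> rho A"
  shows "optimal A B [True]"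
proof -
  let ?l = "rho A"
  have s0: "s > 0" using fixpt_pos(1)[OF pos1_A] s by simp
  have l: "?l > 1" by (rule rho_gt_1[OF pos1_A])
  have den: "e21 A * s + e22 A = ?l"
    using s pos1_entries(3)[OF pos1_A] by (auto simp: fixpt_def)
  then have A: "e11 A * s + e12 A = ?l * s"
    using mob_mult_denom[OF pos1_A s0] mob_fixpt[OF pos1_A] by (simp add: s mult.commute)
  have bound: "e11 (M v) * s + e12 (M v) \<le> ?l ^ length v * s \<and> e21 (M v) * s + e22 (M v) \<le> ?l ^ length v" for v
  proof (induction v)
    case (Cons b v)
    define X where "X = (if b then A else B)"
    define p q where "p = e11 (M v) * s + e12 (M v)" "q = e21 (M v) * s + e22 (M v)"
    let ?r = "?l ^ length v"
    have pq: "p \<le> ?r * s" "q \<le> ?r" using Cons by (simp_all add: p_q_def)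
    have X: "pos1 X" "e11 X * s + e12 X \<le> ?l * s" "e21 X * s + e22 X \<le> ?l"
      using A B den pos1_A pos1_B by (auto simp: X_def)
    note e = pos1_entries[OF X(1)]
    have "e11 X * p + e12 X * q \<le> e11 X * (?r * s) + e12 X * ?r"
      using pq e by (intro add_mono mult_left_mono) auto
    also have "\<dots> = ?r * (e11 X * s + e12 X)" by (simp add: algebra_simps)
    also have "\<dots> \<le> ?r * (?l * s)" using X l by (intro mult_left_mono) auto
    finally have 1: "e11 X * p + e12 X * q \<le> ?l ^ length (b # v) * s" by (simp add: mult_ac)
    have "e21 X * p + e22 X * q \<le> e21 X * (?r * s) + e22 X * ?r"
      using pq e by (intro add_mono mult_left_mono) auto
    also have "\<dots> = ?r * (e21 X * s + e22 X)" by (simp add: algebra_simps)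
    also have "\<dots> \<le> ?r * ?l" using X l by (intro mult_left_mono) auto
    finally have 2: "e21 X * p + e22 X * q \<le> ?l ^ length (b # v)" by (simp add: mult_ac)
    have M: "M (b # v) = X * M v" by (simp add: X_def)
    show ?case using 1 2 unfolding M entries_mult p_q_def by (simp add: algebra_simps)
  qed simp
  have "rho (M v) \<le> ?l ^ length v" if v: "v \<noteq> []" for v
  proof -
    have \<eta>: "rowfix v > 0" by (rule col_row_pos(2)[OF v])
    have pv: "pos1 (flip (M v))" using pos1_M[OF v] by simp
    have "rho (M v) * (rowfix v + s) = form (M v) (rowfix v) s"
      using form_fixpt[OF pv, of s] by (simp add: form_flip[of "M v"] rowfix_def)
    also have "\<dots> \<le> ?l ^ length v * s + rowfix v * ?l ^ length v"
      unfolding form_def using bound[of v] \<eta> by (intro add_mono mult_left_mono) auto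
    also have "\<dots> = ?l ^ length v * (rowfix v + s)" by (simp add: algebra_simps)
    finally show ?thesis using \<eta> s0 by simp
  qed
  then show ?thesis by (simp add: optimal_def)
qed

text \<open>For equal parameters the trace gap between \<open>A * B\<close> and \<open>A * A\<close>
  is, up to the positive factor \<open>d * d'\<close>, the square of \<open>l - 1 / l\<close> times
  \<open>(s' - s) * (u - u')\<close>. So \<open>A * B\<close> beats \<open>A\<close> per
  letter.\<close>

lemma not_optimal_A:
  assumes u: "u' < u" "u < 0" and s: "0 < s" "s < s'" and l: "1 < l"
  shows "\<not> optimal (hyp s u l) (hyp s' u' l) [True]"
proof
  let ?A = "hyp s u l" and ?B = "hyp s' u' l"
  assume "optimal ?A ?B [True]"
  then have "rho (word_mat ?A ?B [True, False]) ^ length [True]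
      \<le> rho (word_mat ?A ?B [True]) ^ length [True, False]"
    unfolding optimal_def by blast
  then have le: "rho (?A * ?B) \<le> rho ?A ^ 2" by (simp add: power2_eq_square)
  have A: "pos1 ?A" "rho ?A = l" using hyp_facts u s l by simp_all
  define d d' m where "d = s - u" "d' = s' - u'" "m = 1 / l"
  note defs = this
  have d: "d > 0" "d' > 0" and lm: "l * m = 1" "l \<noteq> m"
    using u s l less_1_mult[OF l l] by (auto simp: defs field_simps)
  have eA: "e11 ?A = (s * l - u * m) / d" "e12 ?A = - (s * u) * (l - m) / d" "e21 ?A = (l - m) / d"
    "e22 ?A = (s * m - u * l) / d"
    by (simp_all add: entries_hyp defs)
  have eB: "e11 ?B = (s' * l - u' * m) / d'" "e12 ?B = - (s' * u') * (l - m) / d'"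
    "e21 ?B = (l - m) / d'" "e22 ?B = (s' * m - u' * l) / d'"
    by (simp_all add: entries_hyp defs)
  have "tr2 (?A * ?A) = l\<^sup>2 + m\<^sup>2"
    using tr2_eq_rho[OF pos1_mult[OF A(1) A(1)]] rho_power[OF A(1), of 2] A(2)
    by (simp add: power2_eq_square defs(3))
  then have AA: "d * d' * tr2 (?A * ?A) = (s - u) * (s' - u') * (l\<^sup>2 + m\<^sup>2)"
    by (simp add: defs(1,2))
  have "d * d' * tr2 (?A * ?B) = (s * l - u * m) * (s' * l - u' * m) + (s * m - u * l) * (s' * m - u' * l)
      - (s * u + s' * u') * (l - m)\<^sup>2"
    unfolding tr2_def entries_mult eA eB using d by (simp add: field_simps power2_eq_square)
  also have "\<dots> - (s - u) * (s' - u') * (l\<^sup>2 + m\<^sup>2) = (l - m)\<^sup>2 * ((s' - s) * (u - u'))"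
    by (simp add: power2_eq_square algebra_simps)
  finally have "d * d' * tr2 (?A * ?B) - d * d' * tr2 (?A * ?A) > 0"
    unfolding AA using lm u s by simp
  then have "d * d' * (tr2 (?A * ?B) - tr2 (?A * ?A)) > 0" by (simp add: algebra_simps)
  then have "tr2 (?A * ?B) - tr2 (?A * ?A) > 0"
    by (rule zero_less_mult_pos) (rule mult_pos_pos[OF d])
  then have "tr2 (?A * ?A) < tr2 (?A * ?B)" by simp
  then have "rho (?A * ?A) < rho (?A * ?B)" by (intro rho_mono_tr2 pos1_mult A)
  then show False using le rho_power[OF A(1), of 2] by (simp add: power2_eq_square)
qed

lemma continuous_on_word_mat:
  assumes "0 \<notin> I"
  shows "continuous_on I (\<lambda>l. e11 (word_mat (hyp s u l) B w)) \<and>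
    continuous_on I (\<lambda>l. e12 (word_mat (hyp s u l) B w)) \<and>
    continuous_on I (\<lambda>l. e21 (word_mat (hyp s u l) B w)) \<and>
    continuous_on I (\<lambda>l. e22 (word_mat (hyp s u l) B w))"
proof (induction w)
  case (Cons b w)
  have "continuous_on I (\<lambda>l. e11 (hyp s u l))" "continuous_on I (\<lambda>l. e12 (hyp s u l))"
    "continuous_on I (\<lambda>l. e21 (hyp s u l))" "continuous_on I (\<lambda>l. e22 (hyp s u l))"
    unfolding entries_hyp divide_inverse using assms by (auto intro!: continuous_intros)
  then show ?case using Cons by (cases b) (auto intro!: continuous_intros)
qed simp

text \<open>Each competitor \<open>v\<close> imposes a closed condition by continuity, and the set
  is their intersection. The bound \<open>0 < a\<close> keeps the interval away from the pole of
  \<open>1 / l\<close>.\<close>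

lemma closed_optimal:
  assumes "0 < a"
  shows "closed {l \<in> {a..b}. optimal (hyp s u l) B w}"
proof (cases "w = []")
  case False
  have "0 \<notin> {a..b}" using assms by simp
  note entries = continuous_on_word_mat[OF this, of s u B]
  have tr: "continuous_on {a..b} (\<lambda>l. tr2 (word_mat (hyp s u l) B v))" for v
    unfolding tr2_def by (intro continuous_on_add) (use entries[of v] in blast)+
  have rho: "continuous_on {a..b} (\<lambda>l. rho (word_mat (hyp s u l) B v))" for v
    unfolding rho_def
    by (intro continuous_on_divide continuous_on_add continuous_on_real_sqrt continuous_on_diff
        continuous_on_power continuous_on_const tr) simp
  define g where "g = (\<lambda>v l. rho (word_mat (hyp s u l) B w) ^ length v
    - rho (word_mat (hyp s u l) B v) ^ length w)"
  have "continuous_on {a..b} (g v)" for v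
    unfolding g_def by (intro continuous_on_diff continuous_on_power rho)
  then have cl: "closed (g v -` {0..} \<inter> {a..b})" for v
    using continuous_on_closed_vimage[OF closed_atLeastAtMost] closed_atLeast by blast
  have iff: "optimal (hyp s u l) B w \<longleftrightarrow> (\<forall>v. v \<noteq> [] \<longrightarrow> g v l \<in> {0..})" for l
    using False by (simp add: optimal_def g_def)
  have "{l \<in> {a..b}. optimal (hyp s u l) B w} = {a..b} \<inter> (\<Inter>v\<in>{v. v \<noteq> []}. g v -` {0..} \<inter> {a..b})"
    unfolding iff by blast
  also have "closed \<dots>"
    by (intro closed_Int[OF closed_atLeastAtMost closed_INT] ballI cl)
  finally show ?thesis .
qed (simp add: optimal_def)

theorem proposition5p5:
  fixes s u s' u' l' :: real
  assumes "u' < u" and "u < 0" and "0 < s" and "s < s'" and "1 < l'"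
  shows "uncountable {l. l' \<le> l \<and> finiteness_counterexample (H s u l) (H s' u' l')}"
proof
  let ?C = "{l. l' \<le> l \<and> finiteness_counterexample (H s u l) (H s' u' l')}"
  assume countable: "countable ?C"
  define A B where "A = hyp s u" "B = hyp s' u' l'"
  note AB = this
  have cop: "coparallel (A l) B" if "l' \<le> l" for l
    unfolding AB using assms that by (intro coparallel_hyp) auto
  have pp: "positive_pair (A l) B" if "l' \<le> l" for l
    using cop[OF that] by (simp add: coparallel_def)
  \<comment> \<open>At \<open>L\<close> the matrix \<open>B\<close> stretches each entry of
    \<open>(s, 1)\<close> by at most the spectral radius of \<open>A\<close>, so that
    \<open>A\<close> alone is maximizing at the right end.\<close>
  define L where "L = Max {l', (e11 B * s + e12 B) / s, e21 B * s + e22 B}"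
  have L: "l' \<le> L" "(e11 B * s + e12 B) / s \<le> L" "e21 B * s + e22 B \<le> L"
    unfolding L_def by (auto intro: Max_ge)
  define S where "S w = {l \<in> {l'..L}. optimal (A l) B w}" for w
  define E where "E = {l \<in> {l'..L}. \<forall>w. \<not> optimal (A l) B w}"
  \<comment> \<open>Restricting the index words to Christoffel form is what makes \<open>S v\<close>
    and \<open>S w\<close> equal once they meet.\<close>
  define W where "W = {w :: bool list. w \<noteq> [] \<and> w = christoffel (length w) (count_list w True)}"
  define \<F> where "\<F> = S ` W \<union> (\<lambda>e. {e}) ` E"
  have "l \<in> ?C" if "l \<in> E" for l
  proof -
    have l: "l' \<le> l" using that by (simp add: E_def)
    have "H s u l = to_mat (A l)" "H s' u' l' = to_mat B"
      unfolding AB using assms by (auto intro: H_eq_to_mat)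
    then have "\<not> (\<exists>Xs. spectrum_maximizing_product (H s u l) (H s' u' l') Xs)"
      using positive_pair.spectrum_maximizing_product_iff[OF pp[OF l]] that by (simp add: E_def)
    then show ?thesis
      using l assms H_in_GL2_pos(2)[of u s l] H_in_GL2_pos(2)[of u' s' l']
      by (simp add: finiteness_counterexample_def)
  qed
  then have "countable E" by (intro countable_subset[OF subsetI countable])
  then have "countable \<F>" by (simp add: \<F>_def)
  moreover have "closed T" if "T \<in> \<F>" for T
  proof -
    have "closed (S w)" for w
      unfolding S_def AB(1) by (rule closed_optimal) (use assms(5) in simp)
    then show ?thesis using that by (auto simp: \<F>_def)
  qed
  moreover have disj: "T \<inter> U = {}" if TU: "T \<in> \<F>" "U \<in> \<F>" "T \<noteq> U" for T U
  proof (rule ccontr)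
    assume "T \<inter> U \<noteq> {}"
    then obtain l where l: "l \<in> T" "l \<in> U" by blast
    have SE: "S w \<inter> E = {}" for w by (auto simp: S_def E_def)
    have shape: "(\<exists>w\<in>W. X = S w) \<or> (l \<in> E \<and> X = {l})" if "X \<in> \<F>" "l \<in> X" for X
      using that by (auto simp: \<F>_def)
    have "l \<notin> E" if "l \<in> S w" for w using that SE[of w] by blast
    then obtain v w where vw: "v \<in> W" "w \<in> W" "T = S v" "U = S w"
      using shape[OF TU(1) l(1)] shape[OF TU(2) l(2)] TU(3) l by metis
    have "l' \<le> l" "optimal (A l) B v" "optimal (A l) B w" using l vw by (auto simp: S_def)
    then have slope: "length v * count_list w True = length w * count_list v True"
      using coparallel.optimal_slope[OF cop] by blast
    have len: "length v > 0" "length w > 0" using vw by (auto simp: W_def)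
    have eq: "concat (replicate (length w) v) = concat (replicate (length v) w)"
      using christoffel_same_slope[OF len slope] vw by (simp add: W_def)
    have "optimal (A l) B v \<longleftrightarrow> optimal (A l) B w" if "l' \<le> l" for l
      using positive_pair.optimal_concat_replicate[OF pp[OF that], OF len(1), of w]
        positive_pair.optimal_concat_replicate[OF pp[OF that], OF len(2), of v] eq by simp
    then have "S v = S w" by (auto simp: S_def)
    then show False using vw TU by simp
  qed
  moreover have "{l'..L} \<subseteq> \<Union>\<F>"
  proof
    fix l assume l: "l \<in> {l'..L}"
    show "l \<in> \<Union>\<F>"
    proof (cases "l \<in> E")
      case False
      then obtain w where "optimal (A l) B w" using l by (auto simp: E_def)
      then obtain v where v: "optimal (A l) B v" "v = christoffel (length v) (count_list v True)"
        using coparallel.optimal_christoffel[OF cop] l by (metis atLeastAtMost_iff)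
      then have "v \<in> W" "l \<in> S v" using l by (auto simp: W_def S_def optimal_def)
      then show ?thesis by (auto simp: \<F>_def)
    qed (auto simp: \<F>_def)
  qed
  ultimately obtain T where T: "T \<in> \<F>" "{l'..L} \<subseteq> T"
    using interval_countable_closed_partition[of \<F> l' L] L(1) by blast
  have "L > 1" using L(1) assms(5) by simp
  then have "optimal (A L) B [True]"
    using L assms by (intro positive_pair.optimal_A_if_dominant[OF pp[OF L(1)], of s])
      (simp_all add: AB(1) hyp_facts divide_le_eq)
  then have "L \<in> S [True]" using L(1) by (simp add: S_def)
  \<comment> \<open>\<open>[True]\<close> is the Christoffel word of length 1 with one
    \<open>True\<close>: its single comparison is \<open>1 - 1 \<le> 0\<close>.\<close>
  moreover have "S [True] \<in> \<F>" by (auto simp: \<F>_def W_def christoffel_def)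
  moreover have "L \<in> T" using T(2) L(1) by auto
  ultimately have "T = S [True]" using disj T(1) by blast
  moreover have "l' \<in> T" using T(2) L(1) by auto
  ultimately have "optimal (A l') B [True]" by (simp add: S_def)
  then show False using not_optimal_A[OF assms(1-4)] assms(5) by (simp add: AB)
qed

end
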